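(* Let $K$ be a non-archimedean local field with residue field of cardinality $q$, and let $\psi$ be a non-trivial additive character of $K$ of conductor $0$. Let $d_1,\dots,d_k\ge1$ be integers with $d_1+\cdots+d_k=n$, let $s_1,\dots,s_k\in\mathbb C$, put $z_j=q^{-s_j}$, and let $$(V,N)=\omega_{s_1}\otimes\mathrm{Sp}(d_1)\oplus\cdots\oplus\omega_{s_k}\otimes\mathrm{Sp}(d_k).$$ Then $$\varepsilon_K((V,N),\psi)=\left(\prod_{j=1}^k(-1)^{d_j-1}q^{-(d_j-1)(d_j-2)/2}\right)\prod_{j=1}^kz_j^{d_j-1}.$$ Moreover, suppose the partition $d_1+\cdots+d_k=n$ has distinct parts $t_1<\cdots<t_m$, with $t_i$ repeated $r_i$ times, so that $r_1t_1+\cdots+r_mt_m=n$. Then, as a function of $(z_1,\dots,z_k)$ on the complex torus $(\mathbb C^\times)^{r_1+\cdots+r_m}=(\mathbb C^\times)^{r_1}\times\cdots\times(\mathbb C^\times)^{r_m}$ (coordinates grouped according to the value of $d_j$), the epsilon factor is invariant under the product of symmetric groups $\mathfrak S_{r_1}\times\cdots\times\mathfrak S_{r_m}$ permuting the coordinates within each group, and therefore factors through the quotient variety $$(\mathbb C^\times)^{r_1}/\mathfrak S_{r_1}\times\cdots\times(\mathbb C^\times)^{r_m}/\mathfrak S_{r_m}.$$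
   Context: $W_K$ is the Weil group of $K$, $\mathrm{Art}_K:W_K\to K^\times$ the local Artin reciprocity map, normalized so that a geometric Frobenius $\Phi\in W_K$ maps to a uniformizer. $\|w\|=q^{-\mathrm{val}_K(\mathrm{Art}_K(w))}$ with $\mathrm{val}_K$ the normalized valuation, $I$ is the inertia subgroup (the kernel of $\|\cdot\|$), and $\omega_s(w)=\|w\|^s$ for $s\in\mathbb C$. A Weil--Deligne representation is a pair $(V,N)$: a continuous finite-dimensional complex representation $\rho$ of $W_K$ on $V$ together with a nilpotent $N\in\mathrm{End}(V)$ with $\rho(w)N\rho(w)^{-1}=\|w\|N$. $\mathrm{Sp}(d)$ is $\mathbb C^d=\mathbb Ce_0+\cdots+\mathbb Ce_{d-1}$ with $\rho(w)e_i=\|w\|^ie_i$, $Ne_i=e_{i+1}$ for $0\le i\le d-2$, $Ne_{d-1}=0$. In $\omega_s\otimes\mathrm{Sp}(d)$ the nilpotent operator is $1\otimes N$. The conductor of $\psi$ is the largest integer $n(\psi)$ such that $\psi$ is trivial on $\varpi^{-n(\psi)}\mathcal O$, where $\mathcal O$ is the ring of integers and $\varpi$ a uniformizer. For a representation $V$ of $W_K$, $\varepsilon_K(V,\psi)$ is the local epsilon factor in Langlands' normalization: it is additive in $V$ ($\varepsilon_K(V\oplus V',\psi)=\varepsilon_K(V,\psi)\varepsilon_K(V',\psi)$), is inductive in degree $0$ over finite separable extensions $L/K$ (using $\psi\circ\mathrm{Tr}_{L/K}$ on $L$), and for a quasicharacter $\chi$ (viewed on $K^\times$ via $\mathrm{Art}_K$)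 is $$\varepsilon_K(\chi,\psi)=\chi(c)\frac{\int_{\mathcal O^\times}\chi^{-1}(u)\psi(u/c)\,du}{\left|\int_{\mathcal O^\times}\chi^{-1}(u)\psi(u/c)\,du\right|},\qquad \mathrm{val}_K(c)=a(\chi)+n(\psi),$$ where $a(\chi)$ is the Artin conductor exponent of $\chi$ (equal to $0$ for unramified $\chi$). For a Weil--Deligne representation, $$\varepsilon_K((V,N),\psi)=\varepsilon_K(V,\psi)\,\det(-\Phi\mid V^I/V^I_N),$$ where $V_N=\ker N$ and $V^I_N=V^I\cap\ker N$ (the determinant on the zero space is $1$). *)

theory Defs
  imports
    "HOL-Analysis.Analysis"
    "HOL-Combinatorics.Permutations"
    "HOL-Library.FuncSet"
    "Jordan_Normal_Form.Determinant"
    "Jordan_Normal_Form.Matrix_Kernel"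
begin

section \<open>Local fields inside a separable closure\<close>

text \<open>
  All fields live inside one type: a local field \<^term>\<open>K\<close> is a subset of a type that is a separable
  closure of \<^term>\<open>K\<close>, and the finite separable extensions of \<^term>\<open>K\<close> are its finite intermediate
  fields. The absolute value of \<^term>\<open>K\<close> extends uniquely to its separable closure; the class
  provides this extension, so every intermediate field carries its own absolute value. All notions
  below only depend on the equivalence class of \<open>vabs\<close>, whose scaling is arbitrary.
\<close>

class nonarch_valued_field = field +
  fixes vabs :: "'a \<Rightarrow> real"
  assumes vabs_nonneg: "0 \<le> vabs x"
    and vabs_eq_0_iff: "vabs x = 0 \<longleftrightarrow> x = 0"
    and vabs_mult: "vabs (x * y) = vabs x * vabs y"
    and vabs_ultrametric: "vabs (x + y) \<le> max (vabs x) (vabs y)"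

definition vdist :: "'a::nonarch_valued_field \<Rightarrow> 'a \<Rightarrow> real" where
  "vdist x y = vabs (x - y)"

definition is_subfield :: "'a::field set \<Rightarrow> bool" where
  "is_subfield L \<longleftrightarrow> 0 \<in> L \<and> 1 \<in> L \<and>
     (\<forall>x\<in>L. \<forall>y\<in>L. x + y \<in> L \<and> x * y \<in> L) \<and> (\<forall>x\<in>L. - x \<in> L \<and> inverse x \<in> L)"

definition finite_ext :: "'a::field set \<Rightarrow> 'a set \<Rightarrow> bool" where
  "finite_ext L M \<longleftrightarrow> is_subfield L \<and> is_subfield M \<and> L \<subseteq> M \<and>
     (\<exists>B. finite B \<and> B \<subseteq> M \<and> (\<forall>x\<in>M. \<exists>c. (\<forall>b\<in>B. c b \<in> L) \<and> x = (\<Sum>b\<in>B. c b * b)))"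

definition ring_of_integers :: "'a::nonarch_valued_field set \<Rightarrow> 'a set" where
  "ring_of_integers L = {x \<in> L. vabs x \<le> 1}"

definition unit_group :: "'a::nonarch_valued_field set \<Rightarrow> 'a set" where
  "unit_group L = {x \<in> L. vabs x = 1}"

definition residue_field :: "'a::nonarch_valued_field set \<Rightarrow> 'a set set" where
  "residue_field L = ring_of_integers L //
     {(x, y). x \<in> ring_of_integers L \<and> y \<in> ring_of_integers L \<and> vabs (x - y) < 1}"

definition residue_card :: "'a::nonarch_valued_field set \<Rightarrow> nat" where
  "residue_card L = card (residue_field L)"

definition uniformizer :: "'a::nonarch_valued_field set \<Rightarrow> 'a \<Rightarrow> bool" where
  "uniformizer L p \<longleftrightarrow> p \<in> L \<and> 0 < vabs p \<and> vabs p < 1 \<and>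
     (\<forall>x\<in>L - {0}. \<exists>n::int. vabs x = vabs p powi n)"

definition nonarch_local_field :: "'a::nonarch_valued_field set \<Rightarrow> bool" where
  "nonarch_local_field L \<longleftrightarrow> is_subfield L \<and> (\<exists>p. uniformizer L p) \<and>
     Metric_space.mcomplete L vdist \<and> finite (residue_field L)"

text \<open>The normalized valuation; only used on nonzero elements.\<close>

definition val :: "'a::nonarch_valued_field set \<Rightarrow> 'a \<Rightarrow> int" where
  "val L x = (THE n. \<exists>p. uniformizer L p \<and> vabs x = vabs p powi n)"

definition separable_closure_of :: "'a::field set \<Rightarrow> bool" where
  "separable_closure_of K \<longleftrightarrow>
     (\<forall>x::'a. \<exists>p. p \<noteq> 0 \<and> (\<forall>i. poly.coeff p i \<in> K) \<and> coprime p (pderiv p) \<and> poly p x = 0) \<and>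
     (\<forall>p::'a poly. degree p > 0 \<and> coprime p (pderiv p) \<longrightarrow> (\<exists>x. poly p x = 0))"


section \<open>Galois groups, Weil groups, traces and norms\<close>

definition gal_group :: "'a::field set \<Rightarrow> ('a \<Rightarrow> 'a) set" where
  "gal_group L = {\<sigma>. bij \<sigma> \<and> (\<forall>x y. \<sigma> (x + y) = \<sigma> x + \<sigma> y) \<and> (\<forall>x y. \<sigma> (x * y) = \<sigma> x * \<sigma> y) \<and>
     (\<forall>x\<in>L. \<sigma> x = x)}"

text \<open>
  \<open>w\<close> acts on the residue field of the separable closure as the \<open>n\<close>-th power of the arithmetic
  Frobenius, that is, of the map raising to the power \<open>q = residue_card L\<close>.
\<close>

definition acts_as_frob :: "'a::nonarch_valued_field set \<Rightarrow> ('a \<Rightarrow> 'a) \<Rightarrow> int \<Rightarrow> bool" where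
  "acts_as_frob L w n \<longleftrightarrow> (\<forall>x. vabs x \<le> 1 \<longrightarrow>
     (if 0 \<le> n then vabs (w x - x ^ (residue_card L ^ nat n)) < 1
      else vabs ((w x) ^ (residue_card L ^ nat (- n)) - x) < 1))"

definition weil_group :: "'a::nonarch_valued_field set \<Rightarrow> ('a \<Rightarrow> 'a) set" where
  "weil_group L = {w \<in> gal_group L. \<exists>n. acts_as_frob L w n}"

definition inertia_group :: "'a::nonarch_valued_field set \<Rightarrow> ('a \<Rightarrow> 'a) set" where
  "inertia_group L = {w \<in> gal_group L. acts_as_frob L w 0}"

definition geometric_frobenius :: "'a::nonarch_valued_field set \<Rightarrow> ('a \<Rightarrow> 'a) \<Rightarrow> bool" where
  "geometric_frobenius L w \<longleftrightarrow> w \<in> gal_group L \<and> acts_as_frob L w (- 1)"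

text \<open>The inertia group, with its profinite (Krull) topology, is an open subgroup.\<close>

definition weil_topology :: "'a::nonarch_valued_field set \<Rightarrow> ('a \<Rightarrow> 'a) topology" where
  "weil_topology L = topology (\<lambda>U. U \<subseteq> weil_group L \<and>
     (\<forall>w\<in>U. \<exists>S. finite S \<and> {w \<circ> \<tau> |\<tau>. \<tau> \<in> inertia_group L \<and> (\<forall>x\<in>S. \<tau> x = x)} \<subseteq> U))"

definition embeddings :: "'a::field set \<Rightarrow> 'a set \<Rightarrow> ('a \<Rightarrow> 'a) set" where
  "embeddings L M = (\<lambda>\<sigma>. restrict \<sigma> M) ` gal_group L"

definition ext_trace :: "'a::field set \<Rightarrow> 'a set \<Rightarrow> 'a \<Rightarrow> 'a" where
  "ext_trace L M x = (\<Sum>\<tau>\<in>embeddings L M. \<tau> x)"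

definition ext_norm :: "'a::field set \<Rightarrow> 'a set \<Rightarrow> 'a \<Rightarrow> 'a" where
  "ext_norm L M x = (\<Prod>\<tau>\<in>embeddings L M. \<tau> x)"

definition finite_abelian_ext :: "'a::field set \<Rightarrow> 'a set \<Rightarrow> bool" where
  "finite_abelian_ext L M \<longleftrightarrow> finite_ext L M \<and> (\<forall>\<sigma>\<in>gal_group L. \<sigma> ` M = M) \<and>
     (\<forall>\<sigma>\<in>gal_group L. \<forall>\<tau>\<in>gal_group L. \<forall>x\<in>M. \<sigma> (\<tau> x) = \<tau> (\<sigma> x))"

text \<open>
  The properties that characterize the reciprocity map uniquely in local class field theory:
  it is a surjective homomorphism onto the multiplicative group, it sends geometric Frobenius
  elements to uniformizers (more precisely, \<open>w\<close> acts on the residue field as the geometric Frobenius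
  to the power \<open>val L (A w)\<close>), and for every finite abelian extension \<open>M\<close> of \<open>L\<close> it
  identifies \<open>Gal(M/L)\<close> with the norm residue group.
\<close>

definition artin_map :: "'a::nonarch_valued_field set \<Rightarrow> (('a \<Rightarrow> 'a) \<Rightarrow> 'a) \<Rightarrow> bool" where
  "artin_map L A \<longleftrightarrow>
     A ` weil_group L = L - {0} \<and>
     (\<forall>v\<in>weil_group L. \<forall>w\<in>weil_group L. A (v \<circ> w) = A v * A w) \<and>
     (\<forall>w\<in>weil_group L. acts_as_frob L w (- val L (A w))) \<and>
     (\<forall>M. finite_abelian_ext L M \<longrightarrow>
        (\<forall>w\<in>weil_group L. (\<forall>x\<in>M. w x = x) \<longleftrightarrow> A w \<in> ext_norm L M ` (M - {0})))"

definition weil_norm ::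
  "'a::nonarch_valued_field set \<Rightarrow> (('a \<Rightarrow> 'a) \<Rightarrow> 'a) \<Rightarrow> ('a \<Rightarrow> 'a) \<Rightarrow> real" where
  "weil_norm L A w = real (residue_card L) powi (- val L (A w))"

definition omega_char ::
  "'a::nonarch_valued_field set \<Rightarrow> (('a \<Rightarrow> 'a) \<Rightarrow> 'a) \<Rightarrow> complex \<Rightarrow> ('a \<Rightarrow> 'a) \<Rightarrow> complex" where
  "omega_char L A s w = complex_of_real (weil_norm L A w) powr s"


section \<open>Characters and Haar measure of a local field\<close>

definition additive_character :: "'a::nonarch_valued_field set \<Rightarrow> ('a \<Rightarrow> complex) \<Rightarrow> bool" where
  "additive_character L \<psi> \<longleftrightarrow> (\<forall>x\<in>L. \<forall>y\<in>L. \<psi> (x + y) = \<psi> x * \<psi> y) \<and> (\<forall>x\<in>L. cmod (\<psi> x) = 1) \<and>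
     continuous_map (Metric_space.mtopology L vdist) euclidean \<psi>"

definition nontrivial_additive_character ::
  "'a::nonarch_valued_field set \<Rightarrow> ('a \<Rightarrow> complex) \<Rightarrow> bool" where
  "nontrivial_additive_character L \<psi> \<longleftrightarrow> additive_character L \<psi> \<and> (\<exists>x\<in>L. \<psi> x \<noteq> 1)"

definition trivial_on_level :: "'a::nonarch_valued_field set \<Rightarrow> ('a \<Rightarrow> complex) \<Rightarrow> int \<Rightarrow> bool" where
  "trivial_on_level L \<psi> n \<longleftrightarrow>
     (\<forall>p. uniformizer L p \<longrightarrow> (\<forall>x\<in>ring_of_integers L. \<psi> (p powi (- n) * x) = 1))"

definition has_conductor :: "'a::nonarch_valued_field set \<Rightarrow> ('a \<Rightarrow> complex) \<Rightarrow> int \<Rightarrow> bool" where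
  "has_conductor L \<psi> n \<longleftrightarrow>
     trivial_on_level L \<psi> n \<and> (\<forall>m. trivial_on_level L \<psi> m \<longrightarrow> m \<le> n)"

definition quasicharacter :: "'a::nonarch_valued_field set \<Rightarrow> ('a \<Rightarrow> complex) \<Rightarrow> bool" where
  "quasicharacter L \<eta> \<longleftrightarrow>
     (\<forall>x\<in>L - {0}. \<forall>y\<in>L - {0}. \<eta> (x * y) = \<eta> x * \<eta> y) \<and> (\<forall>x\<in>L - {0}. \<eta> x \<noteq> 0) \<and>
     continuous_map (Metric_space.mtopology (L - {0}) vdist) euclidean \<eta>"

definition higher_units :: "'a::nonarch_valued_field set \<Rightarrow> nat \<Rightarrow> 'a set" where
  "higher_units L m = (if m = 0 then unit_group L
     else {u \<in> unit_group L. u = 1 \<or> int m \<le> val L (u - 1)})"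

definition artin_exponent :: "'a::nonarch_valued_field set \<Rightarrow> ('a \<Rightarrow> complex) \<Rightarrow> nat" where
  "artin_exponent L \<eta> = (LEAST m. \<forall>u\<in>higher_units L m. \<eta> u = 1)"

definition haar_measure :: "'a::nonarch_valued_field set \<Rightarrow> 'a measure \<Rightarrow> bool" where
  "haar_measure L \<mu> \<longleftrightarrow>
     space \<mu> = L \<and>
     sets \<mu> = sigma_sets L {U. openin (Metric_space.mtopology L vdist) U} \<and>
     (\<forall>x\<in>L. \<forall>A\<in>sets \<mu>. emeasure \<mu> ((\<lambda>y. x + y) ` A) = emeasure \<mu> A) \<and>
     0 < emeasure \<mu> (ring_of_integers L) \<and> emeasure \<mu> (ring_of_integers L) < \<infinity>"

definition gauss_integral ::
  "'a::nonarch_valued_field set \<Rightarrow> 'a measure \<Rightarrow> ('a \<Rightarrow> complex) \<Rightarrow> ('a \<Rightarrow> complex) \<Rightarrow> 'a \<Rightarrow> complex" where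
  "gauss_integral L \<mu> \<eta> \<psi> c = (LINT u:unit_group L|\<mu>. inverse (\<eta> u) * \<psi> (u / c))"


section \<open>Representations of Weil groups\<close>

text \<open>
  An \<open>n\<close>-dimensional representation is given by its matrices with respect to a basis. Only the
  values of \<open>\<rho>\<close> on the Weil group matter.
\<close>

definition weil_rep ::
  "'a::nonarch_valued_field set \<Rightarrow> nat \<Rightarrow> (('a \<Rightarrow> 'a) \<Rightarrow> complex mat) \<Rightarrow> bool" where
  "weil_rep L n \<rho> \<longleftrightarrow>
     (\<forall>w\<in>weil_group L. \<rho> w \<in> carrier_mat n n) \<and> \<rho> id = 1\<^sub>m n \<and>
     (\<forall>v\<in>weil_group L. \<forall>w\<in>weil_group L. \<rho> (v \<circ> w) = \<rho> v * \<rho> w) \<and>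
     (\<forall>i<n. \<forall>j<n. continuous_map (weil_topology L) euclidean (\<lambda>w. \<rho> w $$ (i, j)))"

definition rep_equiv ::
  "'a::nonarch_valued_field set \<Rightarrow> nat \<Rightarrow> (('a \<Rightarrow> 'a) \<Rightarrow> complex mat) \<Rightarrow>
     (('a \<Rightarrow> 'a) \<Rightarrow> complex mat) \<Rightarrow> bool" where
  "rep_equiv L n \<rho> \<rho>' \<longleftrightarrow> (\<exists>P\<in>carrier_mat n n. invertible_mat P \<and>
     (\<forall>w\<in>weil_group L. P * \<rho> w = \<rho>' w * P))"

definition coset_representatives ::
  "'a::nonarch_valued_field set \<Rightarrow> 'a set \<Rightarrow> ('a \<Rightarrow> 'a) list \<Rightarrow> bool" where
  "coset_representatives M L gs \<longleftrightarrow> set gs \<subseteq> weil_group M \<and>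
     (\<forall>w\<in>weil_group M. \<exists>!i. i < length gs \<and> inv_into UNIV (gs ! i) \<circ> w \<in> weil_group L)"

text \<open>
  The representation of \<open>W_M\<close> induced from the representation \<open>\<rho>\<close> of the subgroup \<open>W_L\<close>, in the
  basis \<open>g_i \<otimes> e_j\<close> of the tensor product of \<open>\<complex>[W_M]\<close> with \<open>\<complex>\<^sup>n\<close> over \<open>\<complex>[W_L]\<close>.
\<close>

definition induced_rep ::
  "'a::nonarch_valued_field set \<Rightarrow> ('a \<Rightarrow> 'a) list \<Rightarrow> nat \<Rightarrow> (('a \<Rightarrow> 'a) \<Rightarrow> complex mat) \<Rightarrow>
     ('a \<Rightarrow> 'a) \<Rightarrow> complex mat" where
  "induced_rep L gs n \<rho> w = mat (length gs * n) (length gs * n) (\<lambda>(a, b).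
     let h = inv_into UNIV (gs ! (a div n)) \<circ> w \<circ> (gs ! (b div n))
     in if h \<in> weil_group L then \<rho> h $$ (a mod n, b mod n) else 0)"

text \<open>
  The epsilon factors \<open>eps L \<psi> n \<rho>\<close> of the \<open>n\<close>-dimensional representations of \<open>W_L\<close>, for all
  finite extensions \<open>L\<close> of \<open>K\<close>. Induction in degree \<open>0\<close> is stated for the virtual representations
  \<open>\<rho> - \<rho>'\<close> with \<open>\<rho>\<close>, \<open>\<rho>'\<close> of equal dimension.
\<close>

definition langlands_epsilon ::
  "'a::nonarch_valued_field set \<Rightarrow> ('a set \<Rightarrow> ('a \<Rightarrow> 'a) \<Rightarrow> 'a) \<Rightarrow> ('a set \<Rightarrow> 'a measure) \<Rightarrow>
     ('a set \<Rightarrow> ('a \<Rightarrow> complex) \<Rightarrow> nat \<Rightarrow> (('a \<Rightarrow> 'a) \<Rightarrow> complex mat) \<Rightarrow> complex) \<Rightarrow> bool" where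
  "langlands_epsilon K art \<mu> eps \<longleftrightarrow>
     (\<forall>L \<psi> n \<rho>. finite_ext K L \<and> nontrivial_additive_character L \<psi> \<and> weil_rep L n \<rho> \<longrightarrow>
        eps L \<psi> n \<rho> \<noteq> 0) \<and>
     (\<forall>L \<psi> n \<rho> \<rho>'. finite_ext K L \<and> nontrivial_additive_character L \<psi> \<and>
        weil_rep L n \<rho> \<and> weil_rep L n \<rho>' \<and> rep_equiv L n \<rho> \<rho>' \<longrightarrow>
        eps L \<psi> n \<rho> = eps L \<psi> n \<rho>') \<and>
     (\<forall>L \<psi> n \<rho> n' \<rho>'. finite_ext K L \<and> nontrivial_additive_character L \<psi> \<and>
        weil_rep L n \<rho> \<and> weil_rep L n' \<rho>' \<longrightarrow>
        eps L \<psi> (n + n') (\<lambda>w. diag_block_mat [\<rho> w, \<rho>' w]) = eps L \<psi> n \<rho> * eps L \<psi> n' \<rho>') \<and>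
     (\<forall>M L \<psi> gs n \<rho> \<rho>'. finite_ext K M \<and> finite_ext M L \<and> nontrivial_additive_character M \<psi> \<and>
        coset_representatives M L gs \<and> weil_rep L n \<rho> \<and> weil_rep L n \<rho>' \<longrightarrow>
        eps M \<psi> (length gs * n) (induced_rep L gs n \<rho>) /
          eps M \<psi> (length gs * n) (induced_rep L gs n \<rho>') =
        eps L (\<psi> \<circ> ext_trace M L) n \<rho> / eps L (\<psi> \<circ> ext_trace M L) n \<rho>') \<and>
     (\<forall>L \<psi> m \<eta> c. finite_ext K L \<and> nontrivial_additive_character L \<psi> \<and> has_conductor L \<psi> m \<and>
        quasicharacter L \<eta> \<and> c \<in> L - {0} \<and> val L c = int (artin_exponent L \<eta>) + m \<longrightarrow>
        eps L \<psi> 1 (\<lambda>w. mat 1 1 (\<lambda>_. \<eta> (art L w))) =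
          \<eta> c * (gauss_integral L (\<mu> L) \<eta> \<psi> c /
            complex_of_real (cmod (gauss_integral L (\<mu> L) \<eta> \<psi> c))))"


section \<open>Weil--Deligne representations\<close>

definition weil_deligne_rep ::
  "'a::nonarch_valued_field set \<Rightarrow> (('a \<Rightarrow> 'a) \<Rightarrow> 'a) \<Rightarrow> nat \<Rightarrow>
     (('a \<Rightarrow> 'a) \<Rightarrow> complex mat) \<Rightarrow> complex mat \<Rightarrow> bool" where
  "weil_deligne_rep L A n \<rho> N \<longleftrightarrow>
     weil_rep L n \<rho> \<and> N \<in> carrier_mat n n \<and> (\<exists>k. N ^\<^sub>m k = 0\<^sub>m n n) \<and>
     (\<forall>w\<in>weil_group L. \<rho> w * N * \<rho> (inv_into UNIV w) = complex_of_real (weil_norm L A w) \<cdot>\<^sub>m N)"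

definition invariants ::
  "nat \<Rightarrow> ('g \<Rightarrow> complex mat) \<Rightarrow> 'g set \<Rightarrow> complex vec set" where
  "invariants n \<rho> G = {v \<in> carrier_vec n. \<forall>w\<in>G. \<rho> w *\<^sub>v v = v}"

text \<open>
  The determinant of the endomorphism that a matrix \<open>T\<close> induces on \<open>U / W\<close>, for \<open>T\<close>-stable subspaces
  \<open>W \<subseteq> U\<close>: the columns of \<open>P\<close> represent a basis of \<open>U / W\<close>, and \<open>A\<close> is the matrix of
  the induced endomorphism in this basis.
\<close>

definition quotient_det ::
  "complex mat \<Rightarrow> complex vec set \<Rightarrow> complex vec set \<Rightarrow> complex" where
  "quotient_det T U W = (THE \<delta>. \<exists>b. \<exists>P\<in>carrier_mat (dim_row T) b. \<exists>A\<in>carrier_mat b b.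
     set (cols P) \<subseteq> U \<and>
     (\<forall>v\<in>U. \<exists>!c. c \<in> carrier_vec b \<and> v - P *\<^sub>v c \<in> W) \<and>
     (\<forall>j<b. T *\<^sub>v col P j - P *\<^sub>v col A j \<in> W) \<and>
     \<delta> = Determinant.det A)"

definition wd_epsilon ::
  "'a::nonarch_valued_field set \<Rightarrow>
     ('a set \<Rightarrow> ('a \<Rightarrow> complex) \<Rightarrow> nat \<Rightarrow> (('a \<Rightarrow> 'a) \<Rightarrow> complex mat) \<Rightarrow> complex) \<Rightarrow>
     ('a \<Rightarrow> 'a) \<Rightarrow> ('a \<Rightarrow> complex) \<Rightarrow> nat \<Rightarrow> (('a \<Rightarrow> 'a) \<Rightarrow> complex mat) \<Rightarrow> complex mat \<Rightarrow> complex" where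
  "wd_epsilon K eps \<Phi> \<psi> n \<rho> N = eps K \<psi> n \<rho> *
     quotient_det (- \<rho> \<Phi>) (invariants n \<rho> (inertia_group K))
       (invariants n \<rho> (inertia_group K) \<inter> mat_kernel N)"

definition sp_rep ::
  "'a::nonarch_valued_field set \<Rightarrow> (('a \<Rightarrow> 'a) \<Rightarrow> 'a) \<Rightarrow> nat \<Rightarrow> ('a \<Rightarrow> 'a) \<Rightarrow> complex mat" where
  "sp_rep K A d w = mat d d (\<lambda>(i, j). if i = j then complex_of_real (weil_norm K A w) ^ i else 0)"

definition sp_nil :: "nat \<Rightarrow> complex mat" where
  "sp_nil d = mat d d (\<lambda>(i, j). if i = j + 1 then 1 else 0)"

definition sum_rep ::
  "'a::nonarch_valued_field set \<Rightarrow> (('a \<Rightarrow> 'a) \<Rightarrow> 'a) \<Rightarrow> nat \<Rightarrow> (nat \<Rightarrow> nat) \<Rightarrow> (nat \<Rightarrow> complex) \<Rightarrow>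
     ('a \<Rightarrow> 'a) \<Rightarrow> complex mat" where
  "sum_rep K A k d s w =
     diag_block_mat (map (\<lambda>j. omega_char K A (s j) w \<cdot>\<^sub>m sp_rep K A (d j) w) [0..<k])"

definition sum_nil :: "nat \<Rightarrow> (nat \<Rightarrow> nat) \<Rightarrow> complex mat" where
  "sum_nil k d = diag_block_mat (map (\<lambda>j. sp_nil (d j)) [0..<k])"


section \<open>Tori and their quotients by symmetric groups\<close>

definition torus :: "nat \<Rightarrow> (nat \<Rightarrow> complex) set" where
  "torus r = {..<r} \<rightarrow>\<^sub>E (UNIV - {0})"

definition torus_product :: "nat \<Rightarrow> (nat \<Rightarrow> nat) \<Rightarrow> (nat \<Rightarrow> nat \<Rightarrow> complex) set" where
  "torus_product m r = (\<Pi>\<^sub>E i\<in>{..<m}. torus (r i))"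

definition sym_orbit_rel :: "nat \<Rightarrow> ((nat \<Rightarrow> complex) \<times> (nat \<Rightarrow> complex)) set" where
  "sym_orbit_rel r = {(x, y). x \<in> torus r \<and>
     (\<exists>\<sigma>. \<sigma> permutes {..<r} \<and> y = restrict (x \<circ> \<sigma>) {..<r})}"

definition sym_quotient_product :: "nat \<Rightarrow> (nat \<Rightarrow> nat) \<Rightarrow> (nat \<Rightarrow> (nat \<Rightarrow> complex) set) set" where
  "sym_quotient_product m r = (\<Pi>\<^sub>E i\<in>{..<m}. torus (r i) // sym_orbit_rel (r i))"

definition quotient_map_product ::
  "nat \<Rightarrow> (nat \<Rightarrow> nat) \<Rightarrow> (nat \<Rightarrow> nat \<Rightarrow> complex) \<Rightarrow> nat \<Rightarrow> (nat \<Rightarrow> complex) set" where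
  "quotient_map_product m r y = (\<lambda>i\<in>{..<m}. sym_orbit_rel (r i) `` {y i})"

text \<open>Regular functions on a torus are the Laurent polynomials in the coordinates.\<close>

definition regular_on_torus ::
  "nat \<Rightarrow> (nat \<Rightarrow> nat) \<Rightarrow> ((nat \<Rightarrow> nat \<Rightarrow> complex) \<Rightarrow> complex) \<Rightarrow> bool" where
  "regular_on_torus m r f \<longleftrightarrow> (\<exists>(S :: (nat \<Rightarrow> nat \<Rightarrow> int) set) c. finite S \<and>
     (\<forall>y\<in>torus_product m r. f y = (\<Sum>e\<in>S. c e * (\<Prod>i<m. \<Prod>l<r i. y i l powi e i l))))"

text \<open>
  The coordinate ring of the quotient variety is the ring of invariants: a function on the quotient
  is regular iff its pullback to the torus is regular.
\<close>

definition regular_on_quotient ::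
  "nat \<Rightarrow> (nat \<Rightarrow> nat) \<Rightarrow> ((nat \<Rightarrow> (nat \<Rightarrow> complex) set) \<Rightarrow> complex) \<Rightarrow> bool" where
  "regular_on_quotient m r F \<longleftrightarrow> regular_on_torus m r (F \<circ> quotient_map_product m r)"

end

theory Submission
  imports Defs
begin

text \<open>
  In the standard basis the Weil group acts through the diagonal matrices with entries
  \<open>c\<^sub>a powi val (Art w)\<close>, where \<open>c\<^sub>a = q\<^sup>-\<^sup>s / q\<^sup>i\<close> on the \<open>i\<close>-th vector of a block with parameter
  \<open>s\<close>. Such unramified characters have epsilon factor 1 for a character \<open>\<psi>\<close> of conductor 0,
  because their Gauss integral is the volume of the units; so only the determinant of \<open>-\<Phi>\<close>
  contributes. Inertia acts trivially, since the exponent through which an element acts on the residue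
  field of the separable closure is unique, that residue field being infinite. The quotient by
  \<open>ker N\<close> is spanned by all vectors of a block except the last, on which \<open>-\<Phi>\<close> is diagonal with
  entries \<open>-c\<^sub>a\<close>. The result depends on the \<open>z\<^sub>j\<close> through a monomial whose exponents are constant
  on each group of equal \<open>d\<^sub>j\<close>.
\<close>

text \<open>The main obstacle is that the data are given implicitly. \<open>artin_map\<close> only
  says that \<open>w\<close> acts with exponent \<open>- val L (A w)\<close>, while inertia and the
  geometric Frobenius are defined by the exponents 0 and -1, so reading off their valuations
  requires uniqueness of the exponent. \<open>quotient_det\<close> is a definite description over
  all bases of the quotient, of any size, so evaluating it in the standard basis requires
  independence of the basis. The latter is proved inside the image of N: classes modulo ker N become
  columns of \<open>N * P\<close>. The epsilon factor of a character divides a Gauss integral by its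
  absolute value, hence the volume of the units has to be positive and finite, which is derived from
  translation invariance alone.

  The constant of the formula comes from multiplying -q^(-s_j) / q^i over i < d_j - 1: this gives
  the sign (-1)^(d_j - 1), the power z_j^(d_j - 1), and q to the exponent -(0 + 1 + ... + (d_j - 2))
  = -(d_j - 1)(d_j - 2)/2.\<close>

no_notation vec_nth (infixl "$" 90)

section \<open>Absolute value and valuation\<close>

lemma vabs_0 [simp]: "vabs (0::'a::nonarch_valued_field) = 0"
  by (simp add: vabs_eq_0_iff)

lemma vabs_1 [simp]: "vabs (1::'a::nonarch_valued_field) = 1"
  using vabs_mult[of "1::'a" 1] vabs_eq_0_iff[of "1::'a"] by simp

lemma vabs_pos_iff: "0 < vabs x \<longleftrightarrow> x \<noteq> 0"
  using vabs_nonneg[of x] vabs_eq_0_iff[of x] by linarith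

lemma vabs_minus [simp]: "vabs (- x) = vabs (x::'a::nonarch_valued_field)"
proof -
  have "vabs (-1::'a) * vabs (-1::'a) = 1"
    using vabs_mult[of "-1::'a" "-1"] by simp
  then have "vabs (-1::'a) = 1"
    using vabs_nonneg[of "-1::'a"] by (auto simp: square_eq_1_iff)
  then show ?thesis
    using vabs_mult[of "-1" x] by simp
qed

lemma vabs_minus_commute: "vabs (x - y) = vabs (y - (x::'a::nonarch_valued_field))"
  by (metis vabs_minus minus_diff_eq)

lemma vabs_add_le: "vabs x \<le> r \<Longrightarrow> vabs y \<le> r \<Longrightarrow> vabs (x + y) \<le> r"
  using vabs_ultrametric[of x y] by linarith

lemma vabs_add_less: "vabs x < r \<Longrightarrow> vabs y < r \<Longrightarrow> vabs (x + y) < r"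
  using vabs_ultrametric[of x y] by linarith

lemma vabs_diff_trans: "vabs (x - y) < r \<Longrightarrow> vabs (y - z) < r \<Longrightarrow> vabs (x - z) < r"
  using vabs_add_less[of "x - y" r "y - z"] by simp

text \<open>Isosceles principle of the ultrametric. It makes \<open>vabs\<close>, and hence
  \<open>val\<close>, locally constant away from 0.\<close>

lemma vabs_eq_of_close:
  assumes "vabs (x - y) < vabs x"
  shows "vabs y = vabs x"
  using vabs_ultrametric[of "x - y" y] vabs_ultrametric[of x "y - x"] assms
    vabs_minus_commute[of x y] by auto

lemma vabs_le_1_of_close: "vabs (x - y) < 1 \<Longrightarrow> vabs x \<le> 1 \<Longrightarrow> vabs y \<le> 1"
  using vabs_add_le[of x 1 "y - x"] vabs_minus_commute[of x y] by simp

lemma vabs_power [simp]: "vabs (x ^ n) = vabs (x::'a::nonarch_valued_field) ^ n"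
  by (induction n) (auto simp: vabs_mult)

lemma vabs_inverse [simp]: "vabs (inverse x) = inverse (vabs (x::'a::nonarch_valued_field))"
proof (cases "x = 0")
  case False
  then have "vabs x * vabs (inverse x) = 1"
    by (metis vabs_mult vabs_1 right_inverse)
  then show ?thesis
    by (metis inverse_unique)
qed simp

lemma vabs_of_nat_le_1: "vabs (of_nat n :: 'a::nonarch_valued_field) \<le> 1"
  by (induction n) (auto intro: vabs_add_le)

text \<open>Congruences modulo the maximal ideal may be raised to powers: x^(n+1) - y^(n+1) = x (x^n
  - y^n) + (x - y) y^n, with both summands in the ideal.\<close>

lemma vabs_power_diff_less_1:
  fixes x y :: "'a::nonarch_valued_field"
  assumes "vabs (x - y) < 1" "vabs x \<le> 1"
  shows "vabs (x ^ n - y ^ n) < 1"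
proof (induction n)
  case (Suc n)
  have y: "vabs y \<le> 1"
    using vabs_le_1_of_close assms by blast
  have "vabs x * vabs (x ^ n - y ^ n) \<le> vabs (x ^ n - y ^ n)"
    using assms(2) by (intro mult_left_le_one_le) (auto simp: vabs_nonneg)
  then have "vabs (x * (x ^ n - y ^ n)) < 1"
    using Suc by (simp only: vabs_mult)
  moreover have "vabs (x - y) * vabs (y ^ n) \<le> vabs (x - y)"
    using y by (intro mult_right_le_one_le) (auto simp: vabs_nonneg power_le_one)
  then have "vabs ((x - y) * y ^ n) < 1"
    using assms(1) by (simp only: vabs_mult)
  ultimately have "vabs (x * (x ^ n - y ^ n) + (x - y) * y ^ n) < 1"
    by (rule vabs_add_less)
  then show ?case
    by (simp add: algebra_simps)
qed simp

text \<open>The description of \<open>val\<close> ranges over all uniformizers, so it is well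
  defined only because they share one absolute value.\<close>

lemma vabs_uniformizer_unique:
  assumes "uniformizer L p" "uniformizer L p'"
  shows "vabs p = vabs p'"
proof -
  have "vabs p \<le> vabs p'" if up: "uniformizer L p" and up': "uniformizer L p'" for p p'
  proof -
    obtain a :: int where a: "vabs p = vabs p' powi a"
      using up up' unfolding uniformizer_def by (metis DiffI singletonD vabs_0 less_irrefl)
    have p: "0 < vabs p" "vabs p < 1" "0 < vabs p'" "vabs p' < 1"
      using up up' by (auto simp: uniformizer_def)
    \<comment> \<open>An exponent \<open>a\<close> of at most 0 would force \<open>vabs p\<close> to
      be at least 1.\<close>
    have "1 \<le> a"
    proof (rule ccontr)
      assume "\<not> 1 \<le> a"
      then have "vabs p' powi 0 \<le> vabs p' powi a"
        using p by (intro power_int_decreasing) auto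
      then show False using a p by simp
    qed
    then have "vabs p' powi a \<le> vabs p' powi 1"
      using p by (intro power_int_decreasing) auto
    then show ?thesis using a by simp
  qed
  then show ?thesis using assms by (meson order_antisym)
qed

lemma val_eqI:
  assumes p: "uniformizer L p" and x: "vabs x = vabs p powi n"
  shows "val L x = n"
  unfolding val_def
proof (rule the_equality)
  show "\<exists>p. uniformizer L p \<and> vabs x = vabs p powi n" using assms by blast
  fix m assume "\<exists>p. uniformizer L p \<and> vabs x = vabs p powi m"
  then have eq: "vabs p powi m = vabs p powi n"
    using x vabs_uniformizer_unique[OF p] by metis
  have "0 < vabs p" "vabs p < 1" using p by (auto simp: uniformizer_def)
  then show "m = n"
    using power_int_strict_decreasing[of m n "vabs p"] power_int_strict_decreasing[of n m "vabs p"] eq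
    by (cases m n rule: linorder_cases) auto
qed

lemma vabs_eq_powi_val:
  assumes "uniformizer L p" "x \<in> L" "x \<noteq> 0"
  shows "vabs x = vabs p powi (val L x)"
proof -
  obtain n :: int where "vabs x = vabs p powi n"
    using assms by (auto simp: uniformizer_def)
  then show ?thesis using val_eqI assms by metis
qed

lemma val_1: "nonarch_local_field L \<Longrightarrow> vabs x = 1 \<Longrightarrow> val L x = 0"
  unfolding nonarch_local_field_def by (metis power_int_0_right val_eqI)

lemma val_mult:
  assumes "nonarch_local_field L" "x \<in> L" "x \<noteq> 0" "y \<in> L" "y \<noteq> 0"
  shows "val L (x * y) = val L x + val L y"
proof -
  obtain p where p: "uniformizer L p"
    using assms by (auto simp: nonarch_local_field_def)
  then have "vabs p \<noteq> 0" by (auto simp: uniformizer_def)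
  then have "vabs (x * y) = vabs p powi (val L x + val L y)"
    using assms vabs_eq_powi_val[OF p] by (metis vabs_mult power_int_add)
  then show ?thesis using val_eqI p by blast
qed

lemma val_cong: "vabs x = vabs y \<Longrightarrow> val L x = val L y"
  by (simp add: val_def)

section \<open>The residue field\<close>

lemma ring_of_integers_closed:
  assumes "is_subfield L"
  shows "0 \<in> ring_of_integers L" "1 \<in> ring_of_integers L"
    "\<And>x y. x \<in> ring_of_integers L \<Longrightarrow> y \<in> ring_of_integers L \<Longrightarrow> x + y \<in> ring_of_integers L"
    "\<And>x. x \<in> ring_of_integers L \<Longrightarrow> - x \<in> ring_of_integers L"
    "\<And>x y. x \<in> ring_of_integers L \<Longrightarrow> y \<in> ring_of_integers L \<Longrightarrow> x - y \<in> ring_of_integers L"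
proof -
  show add: "x + y \<in> ring_of_integers L"
    if "x \<in> ring_of_integers L" "y \<in> ring_of_integers L" for x y
    using assms that by (auto simp: ring_of_integers_def is_subfield_def intro: vabs_add_le)
  show minus: "- x \<in> ring_of_integers L" if "x \<in> ring_of_integers L" for x
    using assms that by (auto simp: ring_of_integers_def is_subfield_def)
  show "x - y \<in> ring_of_integers L"
    if "x \<in> ring_of_integers L" "y \<in> ring_of_integers L" for x y
    using add[OF _ minus] that by (metis add_uminus_conv_diff)
qed (use assms in \<open>auto simp: ring_of_integers_def is_subfield_def\<close>)

text \<open>Names the congruence written inline in \<open>residue_field\<close>, so that the theory
  of equivalence relations applies to it.\<close>

definition residue_rel :: "'a::nonarch_valued_field set \<Rightarrow> ('a \<times> 'a) set" where
  "residue_rel L =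
     {(x, y). x \<in> ring_of_integers L \<and> y \<in> ring_of_integers L \<and> vabs (x - y) < 1}"

lemma residue_field_eq: "residue_field L = ring_of_integers L // residue_rel L"
  by (simp add: residue_field_def residue_rel_def)

lemma equiv_residue_rel: "equiv (ring_of_integers L) (residue_rel L)"
proof (rule equivI)
  show "residue_rel L \<subseteq> ring_of_integers L \<times> ring_of_integers L"
    by (auto simp: residue_rel_def)
  show "refl_on (ring_of_integers L) (residue_rel L)"
    by (auto simp: residue_rel_def refl_on_def)
  show "sym (residue_rel L)"
    by (auto simp: residue_rel_def sym_def vabs_minus_commute)
  show "trans (residue_rel L)"
    unfolding residue_rel_def trans_def using vabs_diff_trans by blast
qed

lemma residue_card_ge_2:
  assumes "nonarch_local_field L"
  shows "2 \<le> residue_card L"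
proof -
  have fin: "finite (residue_field L)" and sub: "is_subfield L"
    using assms by (auto simp: nonarch_local_field_def)
  let ?c = "\<lambda>x. residue_rel L `` {x}"
  note O = ring_of_integers_closed[OF sub]
  have "?c 0 \<noteq> ?c 1"
    using eq_equiv_class_iff[OF equiv_residue_rel O(1,2)] by (simp add: residue_rel_def)
  then have "card {?c 0, ?c 1} = 2" by simp
  moreover have "{?c 0, ?c 1} \<subseteq> residue_field L"
    using O by (auto simp: residue_field_eq quotientI)
  ultimately show ?thesis
    unfolding residue_card_def using card_mono[OF fin] by metis
qed

text \<open>The residue field is a bare set of classes without ring operations, so arithmetic on it
  is carried out on chosen representatives.\<close>

lemma residue_reps:
  obtains R where
    "\<And>C. C \<in> residue_field L \<Longrightarrow> R C \<in> ring_of_integers L \<and> C = residue_rel L `` {R C}"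
proof -
  have "\<forall>C. \<exists>x. C \<in> residue_field L \<longrightarrow> x \<in> ring_of_integers L \<and> C = residue_rel L `` {x}"
    unfolding residue_field_eq by (metis quotientE)
  then show ?thesis using that by metis
qed

text \<open>Translation by 1 permutes the residue classes, so summing it over a set of representatives
  shows that their number vanishes in the residue field.\<close>

lemma vabs_residue_card_less_1:
  fixes L :: "'a::nonarch_valued_field set"
  assumes "nonarch_local_field L"
  shows "vabs (of_nat (residue_card L) :: 'a) < 1"
proof -
  have fin: "finite (residue_field L)" and sub: "is_subfield L"
    using assms by (auto simp: nonarch_local_field_def)
  note O = ring_of_integers_closed[OF sub]
  let ?c = "\<lambda>x. residue_rel L `` {x}"
  obtain R where R: "\<And>C. C \<in> residue_field L \<Longrightarrow> R C \<in> ring_of_integers L"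
    "\<And>C. C \<in> residue_field L \<Longrightarrow> ?c (R C) = C"
    using residue_reps[of L] by metis
  have ceq: "?c x = ?c y \<longleftrightarrow> vabs (x - y) < 1"
    if "x \<in> ring_of_integers L" "y \<in> ring_of_integers L" for x y
    using eq_equiv_class_iff[OF equiv_residue_rel that] that by (simp add: residue_rel_def)
  have cin: "?c x \<in> residue_field L" if "x \<in> ring_of_integers L" for x
    using that by (simp add: residue_field_eq quotientI)
  have Rc: "vabs (R (?c x) - x) < 1" if "x \<in> ring_of_integers L" for x
    using ceq[OF R(1)[OF cin] that] R(2)[OF cin] that by blast
  define f where "f = (\<lambda>C. ?c (R C + 1))"
  have fR: "f ` residue_field L \<subseteq> residue_field L"
    unfolding f_def using cin[OF O(3)[OF R(1) O(2)]] by blast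
  have inj: "inj_on f (residue_field L)"
  proof (rule inj_onI)
    fix C D assume C: "C \<in> residue_field L" "D \<in> residue_field L" and "f C = f D"
    then have "vabs (R C + 1 - (R D + 1)) < 1"
      using ceq[OF O(3)[OF R(1)[OF C(1)] O(2)] O(3)[OF R(1)[OF C(2)] O(2)]] by (simp add: f_def)
    then have "?c (R C) = ?c (R D)" using ceq[OF R(1) R(1)] C by simp
    then show "C = D" using R(2) C by metis
  qed
  have "sum R (residue_field L) = sum (R \<circ> f) (residue_field L)"
    using sum.reindex[OF inj, of R] by (simp only: endo_inj_surj[OF fin fR inj])
  then have "(\<Sum>C\<in>residue_field L. R (f C) - (R C + 1)) = - of_nat (residue_card L)"
    by (simp add: sum_subtractf sum.distrib residue_card_def)
  moreover have "vabs (\<Sum>C\<in>residue_field L. R (f C) - (R C + 1)) < 1"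
  proof -
    have small: "vabs (R (f C) - (R C + 1)) < 1" if "C \<in> residue_field L" for C
      unfolding f_def using Rc[OF O(3)[OF R(1)[OF that] O(2)]] .
    have "vabs (\<Sum>C\<in>A. R (f C) - (R C + 1)) < 1" if "finite A" "A \<subseteq> residue_field L" for A
      using that by (induction A) (use small in \<open>auto intro: vabs_add_less\<close>)
    then show ?thesis using fin by blast
  qed
  ultimately show ?thesis by (metis vabs_minus)
qed

section \<open>Weil groups\<close>

text \<open>The witness is a root of the separable polynomial \<open>X\<^sup>Q - X - 1\<close>; it shows that the residue
  field of the separable closure is not contained in the field with \<open>Q\<close> elements.\<close>

lemma exists_not_frobenius_fixed:
  fixes K :: "'a::nonarch_valued_field set"
  assumes sep: "separable_closure_of K" and Q: "2 \<le> Q" and small: "vabs (of_nat Q :: 'a) < 1"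
  obtains x :: 'a where "vabs x \<le> 1" "vabs (x ^ Q - x) = 1"
proof -
  define p :: "'a poly" where "p = Polynomial.monom 1 Q + [:- 1, - 1:]"
  have p': "pderiv p = Polynomial.monom (of_nat Q) (Q - 1) - 1"
    by (simp add: p_def pderiv_add pderiv_monom pderiv_pCons one_pCons)
  have deg: "degree p = Q"
    unfolding p_def by (subst degree_add_eq_left) (use Q in \<open>simp_all add: degree_monom_eq\<close>)
  have Q1: "1 - of_nat Q \<noteq> (0::'a)"
    using small by auto
  then have absQ1: "vabs (1 - of_nat Q :: 'a) = 1"
    using vabs_eq_of_close[of "1::'a" "1 - of_nat Q"] small by simp
  \<comment> \<open>The combination Q p - X p' kills the leading term. A common divisor of p and p'
    therefore divides a linear polynomial, and only a common root remains to be excluded.\<close>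
  have lin: "Polynomial.smult (of_nat Q) p - [:0, 1:] * pderiv p = [:- of_nat Q, 1 - of_nat Q:]"
  proof -
    have "[:0, 1:] * Polynomial.monom (of_nat Q :: 'a) (Q - 1) = Polynomial.monom (of_nat Q) Q"
      using Q by (simp add: monom_Suc[symmetric])
    then show ?thesis
      unfolding p' by (simp add: p_def smult_add_right smult_monom algebra_simps)
  qed
  have "coprime p (pderiv p)"
  proof (rule coprimeI)
    fix c assume c: "c dvd p" "c dvd pderiv p"
    then have cl: "c dvd [:- of_nat Q, 1 - of_nat Q:]"
      unfolding lin[symmetric] by (intro dvd_diff dvd_smult dvd_mult)
    have nz: "[:- of_nat Q, 1 - of_nat Q:] \<noteq> (0 :: 'a poly)"
      using Q1 by simp
    then have c0: "c \<noteq> 0" using cl by auto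
    have "degree c \<le> 1"
      using dvd_imp_degree_le[OF cl nz] by (auto split: if_splits)
    moreover have "degree c \<noteq> 1"
    proof
      assume "degree c = 1"
      then obtain a b where ab: "c = [:a, b:]" "b \<noteq> 0"
        by (metis degree1_coeffs)
      define x where "x = - a / b"
      have "poly c x = 0" using ab by (simp add: x_def)
      then have x1: "poly (pderiv p) x = 0" and "poly [:- of_nat Q, 1 - of_nat Q:] x = 0"
        using c cl by (metis dvd_trans poly_eq_0_iff_dvd)+
      then have "x * (1 - of_nat Q) = of_nat Q" by (simp add: algebra_simps)
      then have "vabs x = vabs (of_nat Q :: 'a)"
        using absQ1 by (metis vabs_mult mult.right_neutral)
      then have x: "vabs x < 1" using small by simp
      \<comment> \<open>A common root x satisfies x (1 - Q) = Q and so lies in the maximal ideal;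
        then p'(x) = 0 makes 1 a product with a factor Q of absolute value below 1.\<close>
      have "of_nat Q * x ^ (Q - 1) = 1"
        using x1 unfolding p' by (simp add: poly_monom)
      then have "vabs (of_nat Q :: 'a) * vabs x ^ (Q - 1) = 1"
        by (metis vabs_mult vabs_power vabs_1)
      moreover have "vabs (of_nat Q :: 'a) * vabs x ^ (Q - 1) \<le> vabs (of_nat Q :: 'a)"
        using x by (intro mult_right_le_one_le) (auto simp: vabs_nonneg power_le_one)
      ultimately show False using small by simp
    qed
    ultimately have "degree c = 0" by simp
    then show "c dvd 1" using c0 is_unit_iff_degree by blast
  qed
  then obtain x where "poly p x = 0"
    using sep deg Q unfolding separable_closure_of_def by fastforce
  then have x: "x ^ Q - x = 1" and xQ: "x ^ Q = x + 1"
    by (auto simp: p_def poly_monom algebra_simps)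
  have "vabs x \<le> 1"
  proof (rule ccontr)
    assume gt: "\<not> vabs x \<le> 1"
    \<comment> \<open>If x were not integral, x^Q would outgrow x + 1.\<close>
    have "vabs x ^ Q \<le> vabs x"
      using vabs_add_le[of x "vabs x" 1] gt xQ by (metis vabs_power vabs_1 linear order_refl)
    moreover have "vabs x ^ 1 < vabs x ^ Q"
      using gt Q by (intro power_strict_increasing) auto
    ultimately show False by simp
  qed
  with x show ?thesis using that by simp
qed

section \<open>Exponents of the action on the residue field of the separable closure\<close>

lemma acts_as_frob_nonneg_iff:
  "acts_as_frob L w (int n) \<longleftrightarrow> (\<forall>x. vabs x \<le> 1 \<longrightarrow> vabs (w x - x ^ (residue_card L ^ n)) < 1)"
  by (simp add: acts_as_frob_def)

text \<open>The exponent 0 belongs to the other branch of the definition, but there both conditions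
  read |w x - x| < 1. This lets inertia and Frobenius be treated together.\<close>

lemma acts_as_frob_nonpos_iff:
  "acts_as_frob L w (- int n) \<longleftrightarrow> (\<forall>x. vabs x \<le> 1 \<longrightarrow> vabs (w x ^ (residue_card L ^ n) - x) < 1)"
  by (cases "n = 0") (simp_all add: acts_as_frob_def)

text \<open>\<open>gal_group\<close> does not include invariance of \<open>vabs\<close>, so
  integrality of \<open>w x\<close> is read off from the congruence. For a negative exponent, a
  positive power of \<open>w x\<close> is integral, hence so is \<open>w x\<close>.\<close>

lemma acts_as_frob_integral:
  assumes "nonarch_local_field L" "acts_as_frob L w n" "vabs x \<le> 1"
  shows "vabs (w x) \<le> 1"
proof (cases "0 \<le> n")
  case True
  then have "vabs (x ^ (residue_card L ^ nat n) - w x) < 1"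
    using assms unfolding acts_as_frob_def by (auto simp: vabs_minus_commute)
  then show ?thesis
    by (rule vabs_le_1_of_close) (use assms in \<open>simp add: vabs_nonneg power_le_one\<close>)
next
  case False
  then have "vabs (x - (w x) ^ (residue_card L ^ nat (- n))) < 1"
    using assms unfolding acts_as_frob_def by (auto simp: vabs_minus_commute)
  then have "vabs ((w x) ^ (residue_card L ^ nat (- n))) \<le> 1"
    by (rule vabs_le_1_of_close) (use assms in simp)
  moreover have "0 < residue_card L ^ nat (- n)"
    using residue_card_ge_2[OF assms(1)] by simp
  ultimately show ?thesis
    by (metis vabs_power one_less_power not_le)
qed

text \<open>If \<open>w\<close> acted through two different exponents, a positive power of the \<open>q\<close>-Frobenius would
  act trivially on the residue field of the separable closure.\<close>

lemma acts_as_frob_unique: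
  fixes K :: "'a::nonarch_valued_field set"
  assumes K: "nonarch_local_field K" and sep: "separable_closure_of K"
    and m: "acts_as_frob K w (- int j)" and n: "acts_as_frob K w n"
  shows "n = - int j"
proof -
  let ?q = "residue_card K"
  \<comment> \<open>For positive \<open>e\<close> the number Q = q^e is at least 2 and has absolute
    value below 1, so some integral x has x^Q - x a unit.\<close>
  have no_fix: "e = 0" if "\<And>x::'a. vabs x \<le> 1 \<Longrightarrow> vabs (x ^ (?q ^ e) - x) < 1" for e
  proof (rule ccontr)
    assume "e \<noteq> 0"
    then obtain e' where e: "e = Suc e'" by (cases e) auto
    have "vabs (of_nat ?q :: 'a) * vabs (of_nat (?q ^ e') :: 'a) \<le> vabs (of_nat ?q :: 'a)"
      by (rule mult_right_le_one_le) (auto simp: vabs_nonneg vabs_of_nat_le_1 simp del: of_nat_power)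
    then have "vabs (of_nat (?q ^ e) :: 'a) < 1"
      using vabs_residue_card_less_1[OF K] by (simp add: e vabs_mult)
    moreover have "2 \<le> ?q ^ e"
      using residue_card_ge_2[OF K] e
      by (metis le_trans mult_le_mono2 nat_mult_1_right one_le_power one_le_numeral power_Suc order_trans)
    ultimately show False
      using exists_not_frobenius_fixed[OF sep] that by (metis less_irrefl)
  qed
  have close: "vabs (w x ^ (?q ^ j) - x) < 1" if "vabs x \<le> 1" for x
    using m that by (simp add: acts_as_frob_nonpos_iff)
  show ?thesis
  proof (cases "0 \<le> n")
    case True
    then obtain i where i: "n = int i" by (metis nonneg_int_cases)
    \<comment> \<open>From w x = x^(q^i) and (w x)^(q^j) = x modulo the maximal ideal it follows
      that x^(q^(i+j)) = x there.\<close>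
    have "i + j = 0"
    proof (rule no_fix)
      fix x :: 'a assume x: "vabs x \<le> 1"
      have "vabs (w x - x ^ (?q ^ i)) < 1"
        using n x by (simp add: i acts_as_frob_nonneg_iff)
      then have "vabs (w x ^ (?q ^ j) - (x ^ (?q ^ i)) ^ (?q ^ j)) < 1"
        using vabs_power_diff_less_1 acts_as_frob_integral[OF K n x] by blast
      then have "vabs ((x ^ (?q ^ i)) ^ (?q ^ j) - x) < 1"
        using close[OF x] vabs_minus_commute vabs_diff_trans by metis
      then show "vabs (x ^ (?q ^ (i + j)) - x) < 1"
        by (simp add: power_add power_mult)
    qed
    then show ?thesis using i by simp
  next
    case False
    then obtain i where i: "n = - int i"
      by (metis int_cases2 of_nat_0_le_iff)
    \<comment> \<open>Raising x = (w x)^(q^a) to the power q^(b-a) gives x^(q^(b-a)) = (w x)^(q^b) =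
      x modulo the maximal ideal.\<close>
    have key: "b = a" if "a \<le> b" and
      a: "\<And>x::'a. vabs x \<le> 1 \<Longrightarrow> vabs (w x ^ (?q ^ a) - x) < 1" and
      b: "\<And>x::'a. vabs x \<le> 1 \<Longrightarrow> vabs (w x ^ (?q ^ b) - x) < 1" for a b
    proof -
      have "b - a = 0"
      proof (rule no_fix)
        fix x :: 'a assume x: "vabs x \<le> 1"
        have "vabs (x - w x ^ (?q ^ a)) < 1"
          using a[OF x] by (simp add: vabs_minus_commute)
        then have "vabs (x ^ (?q ^ (b - a)) - (w x ^ (?q ^ a)) ^ (?q ^ (b - a))) < 1"
          using x by (rule vabs_power_diff_less_1)
        moreover have "(w x ^ (?q ^ a)) ^ (?q ^ (b - a)) = w x ^ (?q ^ b)"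
          using \<open>a \<le> b\<close> by (simp flip: power_mult power_add)
        ultimately show "vabs (x ^ (?q ^ (b - a)) - x) < 1"
          using b[OF x] vabs_diff_trans by metis
      qed
      with \<open>a \<le> b\<close> show ?thesis by simp
    qed
    have "vabs (w x ^ (?q ^ i) - x) < 1" if "vabs x \<le> 1" for x
      using n that by (simp add: i acts_as_frob_nonpos_iff)
    then have "i = j"
      using key[of i j] key[of j i] close by (metis nat_le_linear)
    then show ?thesis using i by simp
  qed
qed

section \<open>Group operations on Galois and Weil groups\<close>

lemma gal_group_hom:
  assumes "w \<in> gal_group L"
  shows "w (x + y) = w x + w y" "w (x * y) = w x * w y" "w 0 = 0" "w 1 = 1" "bij w"
    "w (inverse x) = inverse (w x)"
proof -
  show add: "\<And>x y. w (x + y) = w x + w y" and mult: "\<And>x y. w (x * y) = w x * w y"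
    and bij: "bij w"
    using assms by (auto simp: gal_group_def)
  show 0: "w 0 = 0" using add[of 0 0] by (metis add_cancel_right_right add.right_neutral)
  have inj: "w x = w y \<longleftrightarrow> x = y" for x y
    using bij by (metis bij_def inj_eq)
  show 1: "w 1 = 1"
    using mult[of 1 1] inj[of 1 0] 0 by simp
  show "w (inverse x) = inverse (w x)"
  proof (cases "x = 0")
    case False
    then have "w x * w (inverse x) = 1" using mult 1 by (metis right_inverse)
    then show ?thesis by (metis inverse_unique)
  qed (simp add: 0)
qed

lemma gal_group_comp: "v \<in> gal_group L \<Longrightarrow> w \<in> gal_group L \<Longrightarrow> v \<circ> w \<in> gal_group L"
  by (auto simp: gal_group_def intro: bij_comp)

lemma gal_group_inv:
  assumes "w \<in> gal_group L"
  shows "inv_into UNIV w \<in> gal_group L"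
proof -
  note h = gal_group_hom[OF assms]
  have wi: "w (inv_into UNIV w x) = x" for x using h(5) by (simp add: bij_is_surj surj_f_inv_f)
  have iw: "inv_into UNIV w (w x) = x" for x using h(5) by (simp add: bij_is_inj)
  have "inv_into UNIV w (x + y) = inv_into UNIV w x + inv_into UNIV w y" "inv_into UNIV w (x * y) = inv_into UNIV w x * inv_into UNIV w y" for x y
    using iw wi h(1,2) by metis+
  moreover have "inv_into UNIV w x = x" if "x \<in> L" for x
    using assms that iw by (metis (mono_tags, lifting) gal_group_def mem_Collect_eq)
  ultimately show ?thesis
    using bij_imp_bij_inv[OF h(5)] by (simp add: gal_group_def)
qed

lemma id_in_weil_group: "id \<in> weil_group L"
  unfolding weil_group_def gal_group_def using acts_as_frob_nonneg_iff[of L id 0]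
  by (auto intro!: exI[of _ 0])

lemma inertia_group_subset: "inertia_group L \<subseteq> weil_group L"
  by (auto simp: inertia_group_def weil_group_def)

text \<open>The composite acts with the same exponent as \<open>w\<close>, because
  \<open>\<tau>\<close> is the identity modulo the maximal ideal. The basic neighbourhoods of
  \<open>weil_topology\<close> are built from such composites.\<close>

lemma weil_group_inertia_comp:
  assumes L: "nonarch_local_field L" and w: "w \<in> weil_group L" and \<tau>: "\<tau> \<in> inertia_group L"
  shows "w \<circ> \<tau> \<in> weil_group L"
proof -
  obtain n where n: "acts_as_frob L w n" using w by (auto simp: weil_group_def)
  have 0: "acts_as_frob L \<tau> 0" using \<tau> by (simp add: inertia_group_def)
  then have close: "vabs (\<tau> x - x) < 1" if "vabs x \<le> 1" for x
    using that by (simp add: acts_as_frob_def)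
  have int: "vabs (\<tau> x) \<le> 1" if "vabs x \<le> 1" for x
    using acts_as_frob_integral[OF L 0 that] .
  have "acts_as_frob L (w \<circ> \<tau>) n"
  proof (cases "0 \<le> n")
    case True
    have "vabs (w (\<tau> x) - x ^ (residue_card L ^ nat n)) < 1" if x: "vabs x \<le> 1" for x
    proof -
      have "vabs (w (\<tau> x) - \<tau> x ^ (residue_card L ^ nat n)) < 1"
        using n True int[OF x] by (simp add: acts_as_frob_def)
      then show ?thesis
        using vabs_power_diff_less_1[OF close[OF x] int[OF x]] by (rule vabs_diff_trans)
    qed
    then show ?thesis using True by (simp add: acts_as_frob_def)
  next
    case False
    have "vabs (w (\<tau> x) ^ (residue_card L ^ nat (- n)) - x) < 1" if x: "vabs x \<le> 1" for x
    proof -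
      have "vabs (w (\<tau> x) ^ (residue_card L ^ nat (- n)) - \<tau> x) < 1"
        using n False int[OF x] by (simp add: acts_as_frob_def)
      then show ?thesis
        using close[OF x] by (rule vabs_diff_trans)
    qed
    then show ?thesis using False by (simp add: acts_as_frob_def)
  qed
  then show ?thesis
    using w \<tau> gal_group_comp by (auto simp: weil_group_def inertia_group_def)
qed

text \<open>The exponent of the inverse is \<open>- n\<close>: substitute
  \<open>inv_into UNIV w y\<close> for x in the congruence for \<open>w\<close>. This requires that
  element to be integral, which follows because \<open>w\<close> maps the maximal ideal into
  itself.\<close>

lemma weil_group_inv:
  assumes L: "nonarch_local_field L" and w: "w \<in> weil_group L"
  shows "inv_into UNIV w \<in> weil_group L"
proof -
  have wg: "w \<in> gal_group L" using w by (simp add: weil_group_def)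
  obtain n where n: "acts_as_frob L w n" using w by (auto simp: weil_group_def)
  note h = gal_group_hom[OF wg]
  have wi: "w (inv_into UNIV w x) = x" for x using h(5) by (simp add: bij_is_surj surj_f_inv_f)
  have q: "residue_card L \<noteq> 0"
    using residue_card_ge_2[OF L] by simp
  have lt: "vabs (w x) < 1" if x: "vabs x < 1" for x
  proof (cases "0 \<le> n")
    case True
    then have "vabs (w x - x ^ (residue_card L ^ nat n)) < 1"
      using n x by (simp add: acts_as_frob_def)
    moreover have "vabs (x ^ (residue_card L ^ nat n)) < 1"
      using x q by (simp add: vabs_nonneg power_less_one_iff)
    ultimately show ?thesis using vabs_add_less by (metis diff_add_cancel)
  next
    case False
    then have "vabs (w x ^ (residue_card L ^ nat (- n)) - x) < 1"
      using n x by (simp add: acts_as_frob_def)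
    then have "vabs (w x ^ (residue_card L ^ nat (- n))) < 1"
      using x vabs_add_less by (metis diff_add_cancel)
    then show ?thesis using q by (simp add: vabs_nonneg power_less_one_iff)
  qed
  have int: "vabs (inv_into UNIV w y) \<le> 1" if y: "vabs y \<le> 1" for y
  proof (rule ccontr)
    assume "\<not> vabs (inv_into UNIV w y) \<le> 1"
    then have "vabs (inverse (inv_into UNIV w y)) < 1"
      by (simp add: inverse_less_1_iff)
    then have "vabs (inverse y) < 1"
      using lt h(6) wi by metis
    \<comment> \<open>Since \<open>inverse 0 = 0\<close>, the inequality does not exclude y = 0; in
      that case the preimage of y is 0, which is integral.\<close>
    then show False
      using y vabs_nonneg[of y] by (auto simp: inverse_less_1_iff vabs_eq_0_iff lt)
        (metis h(3) h(5) inv_f_f bij_is_inj vabs_0 zero_le_one \<open>\<not> vabs (inv_into UNIV w y) \<le> 1\<close>)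
  qed
  have "acts_as_frob L (inv_into UNIV w) (- n)"
  proof (cases "0 \<le> n")
    case True
    then obtain i where i: "n = int i" by (metis nonneg_int_cases)
    have "vabs (inv_into UNIV w y ^ (residue_card L ^ i) - y) < 1" if y: "vabs y \<le> 1" for y
      using n int[OF y] wi[of y] vabs_minus_commute
      unfolding i acts_as_frob_nonneg_iff by metis
    then show ?thesis unfolding i acts_as_frob_nonpos_iff by blast
  next
    case False
    then obtain i where i: "n = - int i"
      by (metis int_cases2 of_nat_0_le_iff)
    have "vabs (inv_into UNIV w y - y ^ (residue_card L ^ i)) < 1" if y: "vabs y \<le> 1" for y
      using n int[OF y] wi[of y] vabs_minus_commute
      unfolding i acts_as_frob_nonpos_iff by metis
    then show ?thesis unfolding i minus_minus acts_as_frob_nonneg_iff by blast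
  qed
  then show ?thesis
    using gal_group_inv[OF wg] by (auto simp: weil_group_def)
qed

lemma openin_weil_topology:
  "openin (weil_topology L) U \<longleftrightarrow> U \<subseteq> weil_group L \<and>
     (\<forall>w\<in>U. \<exists>S. finite S \<and> {w \<circ> \<tau> |\<tau>. \<tau> \<in> inertia_group L \<and> (\<forall>x\<in>S. \<tau> x = x)} \<subseteq> U)"
proof -
  let ?P = "\<lambda>U. U \<subseteq> weil_group L \<and>
     (\<forall>w\<in>U. \<exists>S. finite S \<and> {w \<circ> \<tau> |\<tau>. \<tau> \<in> inertia_group L \<and> (\<forall>x\<in>S. \<tau> x = x)} \<subseteq> U)"
  \<comment> \<open>\<open>topology\<close> is meaningful only for a predicate of this kind. For an
    intersection, the automorphisms fixing the union of the two finite sets give a common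
    neighbourhood.\<close>
  have "istopology ?P"
    unfolding istopology_def
  proof (intro conjI allI impI)
    fix S T assume S: "?P S" and T: "?P T"
    show "S \<inter> T \<subseteq> weil_group L" using S by blast
    show "\<forall>w\<in>S \<inter> T. \<exists>F. finite F \<and>
      {w \<circ> \<tau> |\<tau>. \<tau> \<in> inertia_group L \<and> (\<forall>x\<in>F. \<tau> x = x)} \<subseteq> S \<inter> T"
    proof
      fix w assume "w \<in> S \<inter> T"
      then obtain F G where "finite F" "finite G"
        "{w \<circ> \<tau> |\<tau>. \<tau> \<in> inertia_group L \<and> (\<forall>x\<in>F. \<tau> x = x)} \<subseteq> S"
        "{w \<circ> \<tau> |\<tau>. \<tau> \<in> inertia_group L \<and> (\<forall>x\<in>G. \<tau> x = x)} \<subseteq> T"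
        using S T by (meson IntD1 IntD2)
      then show "\<exists>F. finite F \<and>
        {w \<circ> \<tau> |\<tau>. \<tau> \<in> inertia_group L \<and> (\<forall>x\<in>F. \<tau> x = x)} \<subseteq> S \<inter> T"
        by (intro exI[of _ "F \<union> G"]) blast
    qed
  next
    fix \<K> assume \<K>: "\<forall>k\<in>\<K>. ?P k"
    then show "\<Union>\<K> \<subseteq> weil_group L" by blast
    show "\<forall>w\<in>\<Union>\<K>. \<exists>F. finite F \<and>
      {w \<circ> \<tau> |\<tau>. \<tau> \<in> inertia_group L \<and> (\<forall>x\<in>F. \<tau> x = x)} \<subseteq> \<Union>\<K>"
    proof
      fix w assume "w \<in> \<Union>\<K>"
      then obtain k F where "k \<in> \<K>" "finite F"
        "{w \<circ> \<tau> |\<tau>. \<tau> \<in> inertia_group L \<and> (\<forall>x\<in>F. \<tau> x = x)} \<subseteq> k"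
        using \<K> by (meson UnionE)
      then show "\<exists>F. finite F \<and>
        {w \<circ> \<tau> |\<tau>. \<tau> \<in> inertia_group L \<and> (\<forall>x\<in>F. \<tau> x = x)} \<subseteq> \<Union>\<K>"
        by blast
    qed
  qed
  then show ?thesis
    unfolding weil_topology_def by (simp add: topology_inverse')
qed

text \<open>With the empty finite set, the basic neighbourhood of \<open>w\<close> is the whole
  coset of inertia, so every preimage under \<open>f\<close> is open.\<close>

lemma continuous_map_weil_topology:
  fixes f :: "('a::nonarch_valued_field \<Rightarrow> 'a) \<Rightarrow> 'b::topological_space"
  assumes L: "nonarch_local_field L"
    and f: "\<And>w \<tau>. w \<in> weil_group L \<Longrightarrow> \<tau> \<in> inertia_group L \<Longrightarrow> f (w \<circ> \<tau>) = f w"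
  shows "continuous_map (weil_topology L) euclidean f"
proof -
  have op: "openin (weil_topology L) {w \<in> weil_group L. f w \<in> U}" for U
    unfolding openin_weil_topology
    using f weil_group_inertia_comp[OF L] by (auto intro!: exI[of _ "{}"])
  have "openin (weil_topology L) (weil_group L)"
    using op[of UNIV] by simp
  then have "topspace (weil_topology L) = weil_group L"
    by (metis openin_weil_topology openin_subset openin_topspace subset_antisym)
  then show ?thesis
    using op by (simp add: continuous_map_def)
qed

section \<open>The norm of the Weil group\<close>

context
  fixes L :: "'a::nonarch_valued_field set" and A
  assumes L: "nonarch_local_field L" and A: "artin_map L A"
begin

lemma artin_mem: "w \<in> weil_group L \<Longrightarrow> A w \<in> L" "w \<in> weil_group L \<Longrightarrow> A w \<noteq> 0"
  using A by (auto simp: artin_map_def)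

lemma artin_comp: "v \<in> weil_group L \<Longrightarrow> w \<in> weil_group L \<Longrightarrow> A (v \<circ> w) = A v * A w"
  using A by (auto simp: artin_map_def)

lemma artin_id: "A id = 1"
  using artin_comp[OF id_in_weil_group id_in_weil_group] artin_mem(2)[OF id_in_weil_group] by simp

lemma val_artin_id: "val L (A id) = 0"
  using val_1[OF L] artin_id by simp

lemma val_artin_comp:
  "v \<in> weil_group L \<Longrightarrow> w \<in> weil_group L \<Longrightarrow> val L (A (v \<circ> w)) = val L (A v) + val L (A w)"
  using val_mult[OF L] artin_mem artin_comp by simp

lemma val_artin_inv: "w \<in> weil_group L \<Longrightarrow> val L (A (inv_into UNIV w)) = - val L (A w)"
proof -
  assume w: "w \<in> weil_group L"
  then have "w \<circ> inv_into UNIV w = id"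
    using gal_group_hom(5)[of w L] by (simp add: weil_group_def bij_is_surj flip: surj_iff)
  then show ?thesis
    using val_artin_comp[OF w weil_group_inv[OF L w]] val_artin_id by simp
qed

context
  assumes sep: "separable_closure_of L"
begin

text \<open>Reciprocity supplies the exponent \<open>- val L (A \<tau>)\<close> and the definition
  of inertia supplies 0; uniqueness equates them.\<close>

lemma val_artin_inertia: "\<tau> \<in> inertia_group L \<Longrightarrow> val L (A \<tau>) = 0"
  using acts_as_frob_unique[OF L sep, of \<tau> 0 "- val L (A \<tau>)"] A inertia_group_subset[of L]
  by (auto simp: inertia_group_def artin_map_def subset_iff)

lemma val_artin_frobenius: "geometric_frobenius L \<Phi> \<Longrightarrow> val L (A \<Phi>) = 1"
  using acts_as_frob_unique[OF L sep, of \<Phi> 1 "- val L (A \<Phi>)"] A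
  by (auto simp: geometric_frobenius_def weil_group_def artin_map_def)

end

end

section \<open>Block decomposition\<close>

definition diagonal :: "nat \<Rightarrow> (nat \<Rightarrow> complex) \<Rightarrow> complex mat" where
  "diagonal n f = mat n n (\<lambda>(a, b). if a = b then f a else 0)"

text \<open>Translates the index of a basis vector of the direct sum into its block j and its
  position i there, which replaces arithmetic with block offsets.\<close>

definition block_index :: "nat \<Rightarrow> (nat \<Rightarrow> nat) \<Rightarrow> (nat \<times> nat) list" where
  "block_index k d = concat (map (\<lambda>j. map (Pair j) [0..<d j]) [0..<k])"

text \<open>The basis vectors that N does not kill: all but the last one of each block.\<close>

definition in_block_succ :: "nat \<Rightarrow> (nat \<Rightarrow> nat) \<Rightarrow> nat \<Rightarrow> bool" where
  "in_block_succ k d b \<longleftrightarrow> Suc (snd (block_index k d ! b)) < d (fst (block_index k d ! b))"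

lemma block_index_0 [simp]: "block_index 0 d = []"
  by (simp add: block_index_def)

lemma block_index_Suc: "block_index (Suc k) d = block_index k d @ map (Pair k) [0..<d k]"
  by (simp add: block_index_def)

lemma length_block_index: "length (block_index k d) = (\<Sum>j<k. d j)"
  by (induction k) (simp_all add: block_index_Suc)

lemma block_index_succ:
  assumes "b < length (block_index k d)" "in_block_succ k d b"
  shows "Suc b < length (block_index k d) \<and> block_index k d ! Suc b =
    (fst (block_index k d ! b), Suc (snd (block_index k d ! b)))"
  using assms
proof (induction k)
  case (Suc k)
  show ?case
  proof (cases "b < length (block_index k d)")
    case True
    then show ?thesis
      using Suc by (simp add: block_index_Suc in_block_succ_def nth_append)
  next
    case False
    then show ?thesis
      using Suc(2,3) by (auto simp: block_index_Suc in_block_succ_def nth_append Suc_diff_le)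
  qed
qed simp

lemma diagonal_carrier [simp]: "diagonal n f \<in> carrier_mat n n"
  by (simp add: diagonal_def)

text \<open>Inductions on the number of blocks append the new block on the right, so the last block
  has to be split off.\<close>

lemma diag_block_mat_snoc:
  assumes "A \<in> carrier_mat m m" "B \<in> carrier_mat l l" "diag_block_mat As = A"
  shows "diag_block_mat (As @ [B]) = four_block_mat A (0\<^sub>m m l) (0\<^sub>m l m) B"
  using assms by (auto simp: diag_block_mat_last Let_def)

lemma diag_block_mat_diagonal:
  "diag_block_mat (map (\<lambda>j. diagonal (d j) (\<lambda>i. f (j, i))) [0..<k]) =
     diagonal (length (block_index k d)) (\<lambda>a. f (block_index k d ! a))"
proof (induction k)
  case 0
  show ?case by (auto simp: diagonal_def)
next
  case (Suc k)
  let ?D = "diagonal (length (block_index k d)) (\<lambda>a. f (block_index k d ! a))"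
  let ?B = "diagonal (d k) (\<lambda>i. f (k, i))"
  have "diag_block_mat (map (\<lambda>j. diagonal (d j) (\<lambda>i. f (j, i))) [0..<Suc k]) =
    four_block_mat ?D (0\<^sub>m (length (block_index k d)) (d k)) (0\<^sub>m (d k) (length (block_index k d))) ?B"
    using diag_block_mat_snoc[OF diagonal_carrier diagonal_carrier Suc] by simp
  also have "\<dots> = diagonal (length (block_index (Suc k) d)) (\<lambda>a. f (block_index (Suc k) d ! a))"
    by (rule eq_matI) (auto simp: diagonal_def block_index_Suc nth_append)
  finally show ?case .
qed

lemma sp_nil_carrier [simp]: "sp_nil m \<in> carrier_mat m m"
  by (simp add: sp_nil_def)

lemma sum_nil_eq:
  "sum_nil k d = mat (length (block_index k d)) (length (block_index k d))
     (\<lambda>(a, b). if a = Suc b \<and> in_block_succ k d b then 1 else 0)"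
proof (induction k)
  case 0
  show ?case by (auto simp: sum_nil_def)
next
  case (Suc k)
  let ?l = "length (block_index k d)"
  let ?N = "mat ?l ?l (\<lambda>(a, b). if a = Suc b \<and> in_block_succ k d b then 1 else 0) :: complex mat"
  have old: "in_block_succ (Suc k) d b = in_block_succ k d b" if "b < ?l" for b
    using that by (simp add: in_block_succ_def block_index_Suc nth_append)
  have new: "in_block_succ (Suc k) d b = (Suc (b - ?l) < d k)" if "\<not> b < ?l" "b < ?l + d k" for b
    using that by (auto simp: in_block_succ_def block_index_Suc nth_append)
  have "sum_nil (Suc k) d = four_block_mat ?N (0\<^sub>m ?l (d k)) (0\<^sub>m (d k) ?l) (sp_nil (d k))"
    using diag_block_mat_snoc[OF _ sp_nil_carrier Suc[unfolded sum_nil_def]]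
    by (simp add: sum_nil_def)
  also have "\<dots> = mat (length (block_index (Suc k) d)) (length (block_index (Suc k) d))
     (\<lambda>(a, b). if a = Suc b \<and> in_block_succ (Suc k) d b then 1 else 0)"
  proof (rule eq_matI)
    fix a b
    assume "a < dim_row (mat (length (block_index (Suc k) d)) (length (block_index (Suc k) d))
     (\<lambda>(a, b). if a = Suc b \<and> in_block_succ (Suc k) d b then 1 else (0::complex)))"
      "b < dim_col (mat (length (block_index (Suc k) d)) (length (block_index (Suc k) d))
     (\<lambda>(a, b). if a = Suc b \<and> in_block_succ (Suc k) d b then 1 else (0::complex)))"
    then have ab: "a < ?l + d k" "b < ?l + d k" by (simp_all add: block_index_Suc)
    \<comment> \<open>The delicate entry is the corner where column ?l - 1 meets row ?l. It vanishes
      because a successor within the old blocks stays below ?l, by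
      \<open>block_index_succ\<close>.\<close>
    show "four_block_mat ?N (0\<^sub>m ?l (d k)) (0\<^sub>m (d k) ?l) (sp_nil (d k)) $$ (a, b) =
      mat (length (block_index (Suc k) d)) (length (block_index (Suc k) d))
       (\<lambda>(a, b). if a = Suc b \<and> in_block_succ (Suc k) d b then 1 else 0) $$ (a, b)"
      using ab old[of b] new[of b] block_index_succ[of b k d]
      by (auto simp: block_index_Suc sp_nil_def Suc_diff_le)
  qed (auto simp: block_index_Suc sp_nil_def)
  finally show ?case .
qed

lemma prod_over_blocks:
  "(\<Prod>a<length (block_index k d). f (block_index k d ! a)) = (\<Prod>j<k. \<Prod>i<d j. f (j, i :: nat))"
  for f :: "nat \<times> nat \<Rightarrow> 'b::comm_monoid_mult"
proof (induction k)
  case (Suc k)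
  let ?l = "length (block_index k d)"
  have "(\<Prod>a<?l + m. f (block_index (Suc k) d ! a)) =
    (\<Prod>a<?l. f (block_index (Suc k) d ! a)) * (\<Prod>i<m. f (block_index (Suc k) d ! (?l + i)))" for m
    by (induction m) (simp_all add: mult.assoc)
  then show ?case
    using Suc by (simp add: block_index_Suc nth_append)
qed simp

section \<open>Diagonal and strictly triangular matrices\<close>

lemma index_diagonal_mult:
  assumes "N \<in> carrier_mat n n" "a < n" "b < n"
  shows "(diagonal n f * N) $$ (a, b) = f a * N $$ (a, b)"
    "(N * diagonal n f) $$ (a, b) = N $$ (a, b) * f b"
proof -
  have "(diagonal n f * N) $$ (a, b) = (\<Sum>c\<in>{0..<n}. (if a = c then f a else 0) * N $$ (c, b))"
    using assms by (simp add: diagonal_def scalar_prod_def)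
  also have "\<dots> = (\<Sum>c\<in>{0..<n}. if c = a then f a * N $$ (a, b) else 0)"
    by (rule sum.cong) auto
  finally show "(diagonal n f * N) $$ (a, b) = f a * N $$ (a, b)"
    using assms by simp
  have "(N * diagonal n f) $$ (a, b) = (\<Sum>c\<in>{0..<n}. N $$ (a, c) * (if c = b then f c else 0))"
    using assms by (simp add: diagonal_def scalar_prod_def)
  also have "\<dots> = (\<Sum>c\<in>{0..<n}. if c = b then N $$ (a, b) * f b else 0)"
    by (rule sum.cong) auto
  finally show "(N * diagonal n f) $$ (a, b) = N $$ (a, b) * f b"
    using assms by simp
qed

lemma diagonal_mult: "diagonal n f * diagonal n g = diagonal n (\<lambda>a. f a * g a)"
proof (rule eq_matI)
  fix a b
  assume "a < dim_row (diagonal n (\<lambda>a. f a * g a))" "b < dim_col (diagonal n (\<lambda>a. f a * g a))"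
  then have ab: "a < n" "b < n" by (simp_all add: diagonal_def)
  show "(diagonal n f * diagonal n g) $$ (a, b) = diagonal n (\<lambda>a. f a * g a) $$ (a, b)"
    using ab unfolding index_diagonal_mult(1)[OF diagonal_carrier ab] by (auto simp: diagonal_def)
qed (simp_all add: diagonal_def)

lemma diagonal_1: "diagonal n (\<lambda>_. 1) = 1\<^sub>m n"
  by (rule eq_matI) (auto simp: diagonal_def)

lemma diagonal_cong: "(\<And>a. a < n \<Longrightarrow> f a = g a) \<Longrightarrow> diagonal n f = diagonal n g"
  by (rule eq_matI) (auto simp: diagonal_def)

lemma det_diagonal: "Determinant.det (diagonal n f) = (\<Prod>a<n. f a)"
proof -
  have "Determinant.det (diagonal n f) = prod_list (diag_mat (diagonal n f))"
    by (rule det_upper_triangular) (auto simp: diagonal_def upper_triangular_def)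
  then show ?thesis
    unfolding prod_list_diag_prod
    by (auto simp: diagonal_def atLeast0LessThan intro!: prod.cong)
qed

lemma strictly_lower_triangular_nilpotent:
  fixes N :: "complex mat"
  assumes N: "N \<in> carrier_mat n n"
    and low: "\<And>a b. a < n \<Longrightarrow> b < n \<Longrightarrow> a \<le> b \<Longrightarrow> N $$ (a, b) = 0"
  shows "N ^\<^sub>m n = 0\<^sub>m n n"
proof -
  \<comment> \<open>Each factor moves the support one diagonal further down; for l = n the condition
    a < b + l holds for every entry.\<close>
  have pow: "(N ^\<^sub>m l) $$ (a, b) = 0" if "a < n" "b < n" "a < b + l" for l a b
    using that
  proof (induction l arbitrary: a b)
    case 0
    then show ?case using N by simp
  next
    case (Suc l)
    \<comment> \<open>Either c is at most b and the second factor vanishes, or c > b gives a < c + l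
      and the first one does.\<close>
    have "(N ^\<^sub>m l) $$ (a, c) * N $$ (c, b) = 0" if "c < n" for c
      using Suc low[of c b] that by (cases "c \<le> b") auto
    then show ?case
      using Suc.prems N pow_carrier_mat[OF N, of l] by (auto simp: scalar_prod_def intro!: sum.neutral)
  qed
  then show ?thesis
    using pow_carrier_mat[OF N, of n] by (intro eq_matI) auto
qed

section \<open>Determinants on a quotient by a kernel\<close>

text \<open>N identifies the quotient by its kernel with its image. This turns statements about
  classes into equations for \<open>N * P\<close>.\<close>

lemma diff_in_mat_kernel_iff:
  assumes "N \<in> carrier_mat n n" "P \<in> carrier_mat n b" "v \<in> carrier_vec n" "c \<in> carrier_vec b"
  shows "v - P *\<^sub>v c \<in> mat_kernel N \<longleftrightarrow> N *\<^sub>v v = (N * P) *\<^sub>v c"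
proof -
  have "N *\<^sub>v (v - P *\<^sub>v c) = N *\<^sub>v v - (N * P) *\<^sub>v c"
    using assms by (subst mult_minus_distrib_mat_vec) auto
  moreover have "x - y = 0\<^sub>v n \<longleftrightarrow> x = y" if "x \<in> carrier_vec n" "y \<in> carrier_vec n"
    for x y :: "'a vec"
    using that by (auto simp: vec_eq_iff)
  ultimately show ?thesis
    using assms by (auto simp: mat_kernel[OF assms(1)])
qed

lemma mat_of_col_witnesses:
  assumes "\<And>j. j < m \<Longrightarrow> \<exists>c\<in>carrier_vec b. Q j c"
  obtains C where "C \<in> carrier_mat b m" "\<And>j. j < m \<Longrightarrow> Q j (col C j)"
proof -
  obtain c where c: "\<And>j. j < m \<Longrightarrow> c j \<in> carrier_vec b \<and> Q j (c j)"
    using assms by metis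
  let ?C = "mat_of_cols b (map c [0..<m])"
  have "col ?C j = c j" if "j < m" for j
    using c that by (subst col_mat_of_cols) auto
  then show ?thesis
    using that[of ?C] c by (auto simp: mat_of_cols_def)
qed

text \<open>The condition inside \<open>quotient_det\<close> for U the whole space and W the kernel
  of N, with its witnesses exposed so that two choices can be compared.\<close>

definition quotient_basis ::
  "complex mat \<Rightarrow> complex mat \<Rightarrow> nat \<Rightarrow> nat \<Rightarrow> complex mat \<Rightarrow> complex mat \<Rightarrow> bool" where
  "quotient_basis N T n b P A \<longleftrightarrow> P \<in> carrier_mat n b \<and> A \<in> carrier_mat b b \<and>
     (\<forall>v\<in>carrier_vec n. \<exists>!c. c \<in> carrier_vec b \<and> v - P *\<^sub>v c \<in> mat_kernel N) \<and>
     (\<forall>j<b. T *\<^sub>v col P j - P *\<^sub>v col A j \<in> mat_kernel N)"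

context
  fixes N T :: "complex mat" and n :: nat
  assumes N: "N \<in> carrier_mat n n" and T: "T \<in> carrier_mat n n"
begin

text \<open>The existence half of the coordinates: the columns of \<open>N * P\<close> span the
  image of N.\<close>

lemma quotient_basis_spans:
  assumes "quotient_basis N T n b P A" "X \<in> carrier_mat n m"
  obtains C where "C \<in> carrier_mat b m" "N * X = N * P * C"
proof -
  have P: "P \<in> carrier_mat n b" using assms by (simp add: quotient_basis_def)
  have "\<exists>c\<in>carrier_vec b. N *\<^sub>v col X j = (N * P) *\<^sub>v c" if "j < m" for j
  proof -
    have X: "col X j \<in> carrier_vec n" using assms(2) by auto
    then obtain c where "c \<in> carrier_vec b" "col X j - P *\<^sub>v c \<in> mat_kernel N"
      using assms unfolding quotient_basis_def by metis
    then show ?thesis using diff_in_mat_kernel_iff[OF N P X] by auto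
  qed
  then obtain C where C: "C \<in> carrier_mat b m"
    "\<And>j. j < m \<Longrightarrow> N *\<^sub>v col X j = (N * P) *\<^sub>v col C j"
    using mat_of_col_witnesses[of m b "\<lambda>j c. N *\<^sub>v col X j = (N * P) *\<^sub>v c"] by metis
  have "N * X = N * P * C"
  proof (rule mat_col_eqI)
    fix j assume "j < dim_col (N * P * C)"
    then have j: "j < m" using C by simp
    then show "col (N * X) j = col (N * P * C) j"
      using C(2)[OF j] col_mult2[OF N assms(2) j]
        col_mult2[OF mult_carrier_mat[OF N P] C(1) j] by simp
  qed (use C assms in auto)
  then show ?thesis using that C by blast
qed

text \<open>The uniqueness half, as a cancellation rule for \<open>N * P\<close>: corresponding
  columns of X and Y are coordinates of the same class.\<close>

lemma quotient_basis_independent: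
  assumes "quotient_basis N T n b P A" "X \<in> carrier_mat b m" "Y \<in> carrier_mat b m"
    and eq: "N * P * X = N * P * Y"
  shows "X = Y"
proof (rule mat_col_eqI)
  have P: "P \<in> carrier_mat n b" using assms by (simp add: quotient_basis_def)
  fix j assume "j < dim_col Y"
  then have j: "j < m" using assms by auto
  have X: "col X j \<in> carrier_vec b" and Y: "col Y j \<in> carrier_vec b"
    using assms by auto
  have v: "P *\<^sub>v col X j \<in> carrier_vec n" using P X by auto
  have "N *\<^sub>v (P *\<^sub>v col X j) = (N * P) *\<^sub>v col X j"
    using N P X by simp
  moreover have "(N * P) *\<^sub>v col X j = (N * P) *\<^sub>v col Y j"
    using col_mult2[OF mult_carrier_mat[OF N P] assms(2) j]
      col_mult2[OF mult_carrier_mat[OF N P] assms(3) j] eq by simp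
  ultimately have "P *\<^sub>v col X j - P *\<^sub>v col X j \<in> mat_kernel N"
    "P *\<^sub>v col X j - P *\<^sub>v col Y j \<in> mat_kernel N"
    using diff_in_mat_kernel_iff[OF N P v X] diff_in_mat_kernel_iff[OF N P v Y] by simp_all
  then show "col X j = col Y j"
    using assms(1) v X Y unfolding quotient_basis_def by blast
qed (use assms in auto)

lemma quotient_basis_action:
  assumes "quotient_basis N T n b P A"
  shows "N * (T * P) = N * P * A"
proof (rule mat_col_eqI)
  have P: "P \<in> carrier_mat n b" and A: "A \<in> carrier_mat b b"
    using assms by (simp_all add: quotient_basis_def)
  have TP: "T * P \<in> carrier_mat n b" using T P by simp
  fix j assume "j < dim_col (N * P * A)"
  then have j: "j < b" using A by simp
  have v: "T *\<^sub>v col P j \<in> carrier_vec n" and c: "col A j \<in> carrier_vec b"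
    using T P A by auto
  have "N *\<^sub>v (T *\<^sub>v col P j) = (N * P) *\<^sub>v col A j"
    using assms j diff_in_mat_kernel_iff[OF N P v c] by (simp add: quotient_basis_def)
  then show "col (N * (T * P)) j = col (N * P * A) j"
    using col_mult2[OF N TP j] col_mult2[OF T P j] col_mult2[OF mult_carrier_mat[OF N P] A j]
    by simp
qed (use assms in \<open>auto simp: quotient_basis_def\<close>)

end

text \<open>Shows below that two bases have equal size: for mutually inverse C and D the two traces
  are the sizes, and the complex numbers have characteristic 0.\<close>

lemma trace_mult_commute:
  fixes C D :: "complex mat"
  assumes "C \<in> carrier_mat b m" "D \<in> carrier_mat m b"
  shows "(\<Sum>i<b. (C * D) $$ (i, i)) = (\<Sum>i<m. (D * C) $$ (i, i))"
proof -
  have "(\<Sum>i<b. (C * D) $$ (i, i)) = (\<Sum>i<b. \<Sum>j<m. C $$ (i, j) * D $$ (j, i))"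
    using assms by (auto simp: scalar_prod_def atLeast0LessThan intro!: sum.cong)
  also have "\<dots> = (\<Sum>j<m. \<Sum>i<b. D $$ (j, i) * C $$ (i, j))"
    by (subst sum.swap) (simp add: mult.commute)
  also have "\<dots> = (\<Sum>i<m. (D * C) $$ (i, i))"
    using assms by (auto simp: scalar_prod_def atLeast0LessThan intro!: sum.cong)
  finally show ?thesis .
qed

text \<open>\<open>T'\<close> is the action of \<open>T\<close> carried over to the image of N; its
  existence makes ker N stable under \<open>T\<close>. The base changes C and D are mutually inverse
  and conjugate A into A'.\<close>

lemma quotient_basis_det_unique:
  assumes N: "N \<in> carrier_mat n n" and T: "T \<in> carrier_mat n n" and T': "T' \<in> carrier_mat n n"
    and NT: "N * T = T' * N"
    and B1: "quotient_basis N T n b P A" and B2: "quotient_basis N T n b' P' A'"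
  shows "Determinant.det A = Determinant.det A'"
proof -
  have P: "P \<in> carrier_mat n b" "A \<in> carrier_mat b b" "P' \<in> carrier_mat n b'" "A' \<in> carrier_mat b' b'"
    using B1 B2 by (simp_all add: quotient_basis_def)
  obtain C where C: "C \<in> carrier_mat b' b" "N * P = N * P' * C"
    using quotient_basis_spans[OF N T B2 P(1)] by metis
  obtain D where D: "D \<in> carrier_mat b b'" "N * P' = N * P * D"
    using quotient_basis_spans[OF N T B1 P(3)] by metis
  define M M' where "M = N * P" and "M' = N * P'"
  have M: "M \<in> carrier_mat n b" "M' \<in> carrier_mat n b'"
    using N P by (simp_all add: M_def M'_def)
  have MC: "M = M' * C" and MD: "M' = M * D"
    using C D by (simp_all add: M_def M'_def)
  have "M * (D * C) = M"
    using assoc_mult_mat[OF M(1) D(1) C(1)] by (simp flip: MC MD)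
  moreover have "M' * (C * D) = M'"
    using assoc_mult_mat[OF M(2) C(1) D(1)] by (simp flip: MC MD)
  ultimately have eq: "M * (D * C) = M * 1\<^sub>m b" "M' * (C * D) = M' * 1\<^sub>m b'"
    using M by simp_all
  have DC: "D * C = 1\<^sub>m b"
    using quotient_basis_independent[OF N T B1, folded M_def, OF _ _ eq(1), of b] C(1) D(1) by simp
  have CD: "C * D = 1\<^sub>m b'"
    using quotient_basis_independent[OF N T B2, folded M'_def, OF _ _ eq(2), of b'] C(1) D(1) by simp
  have "(\<Sum>i<b. (1\<^sub>m b :: complex mat) $$ (i, i)) = (\<Sum>i<b'. (1\<^sub>m b' :: complex mat) $$ (i, i))"
    using trace_mult_commute[OF D(1) C(1)] DC CD by simp
  then have bb: "b = b'" by simp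
  have TM: "T' * M = M * A" "T' * M' = M' * A'"
    using quotient_basis_action[OF N T B1] quotient_basis_action[OF N T B2] NT
      assoc_mult_mat[OF N T P(1)] assoc_mult_mat[OF T' N P(1)]
      assoc_mult_mat[OF N T P(3)] assoc_mult_mat[OF T' N P(3)]
    unfolding M_def M'_def by metis+
  \<comment> \<open>Both C A and A' C describe \<open>T' * M\<close> in the basis M', which can then
    be cancelled.\<close>
  have "M' * (C * A) = M * A"
    using assoc_mult_mat[OF M(2) C(1) P(2)] MC by simp
  also have "\<dots> = T' * (M' * C)"
    using TM MC by simp
  also have "\<dots> = M' * (A' * C)"
    using assoc_mult_mat[OF T' M(2) C(1)] assoc_mult_mat[OF M(2) P(4) C(1)] TM by simp
  finally have "C * A = A' * C"
    using quotient_basis_independent[OF N T B2, of "C * A" b "A' * C"] C(1) P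
    by (simp add: M'_def)
  then have "Determinant.det C * Determinant.det A = Determinant.det A' * Determinant.det C"
    using det_mult[of C b A] det_mult[of A' b C] C(1) P bb by metis
  moreover have "Determinant.det D * Determinant.det C = 1"
    using DC C(1) D(1) bb det_mult[of D b C] by simp
  ultimately show ?thesis by auto
qed

lemma quotient_det_eqI:
  assumes N: "N \<in> carrier_mat n n" and T: "T \<in> carrier_mat n n" and T': "T' \<in> carrier_mat n n"
    and NT: "N * T = T' * N" and B: "quotient_basis N T n b P A"
  shows "quotient_det T (carrier_vec n) (carrier_vec n \<inter> mat_kernel N) = Determinant.det A"
proof -
  have W: "carrier_vec n \<inter> mat_kernel N = mat_kernel N"
    using N by (auto simp: mat_kernel)
  have cols: "set (cols Q) \<subseteq> carrier_vec n" if "Q \<in> carrier_mat n m" for Q :: "complex mat" and m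
    using that cols_dim by blast
  show ?thesis
    unfolding quotient_det_def W
  proof (rule the_equality)
    show "\<exists>b. \<exists>P\<in>carrier_mat (dim_row T) b. \<exists>A'\<in>carrier_mat b b. set (cols P) \<subseteq> carrier_vec n \<and>
      (\<forall>v\<in>carrier_vec n. \<exists>!c. c \<in> carrier_vec b \<and> v - P *\<^sub>v c \<in> mat_kernel N) \<and>
      (\<forall>j<b. T *\<^sub>v col P j - P *\<^sub>v col A' j \<in> mat_kernel N) \<and>
      Determinant.det A = Determinant.det A'"
      by (intro exI[of _ b] bexI[of _ P] bexI[of _ A])
        (use B T cols in \<open>auto simp: quotient_basis_def\<close>)
  next
    fix \<delta>
    assume "\<exists>b. \<exists>P\<in>carrier_mat (dim_row T) b. \<exists>A\<in>carrier_mat b b. set (cols P) \<subseteq> carrier_vec n \<and>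
      (\<forall>v\<in>carrier_vec n. \<exists>!c. c \<in> carrier_vec b \<and> v - P *\<^sub>v c \<in> mat_kernel N) \<and>
      (\<forall>j<b. T *\<^sub>v col P j - P *\<^sub>v col A j \<in> mat_kernel N) \<and> \<delta> = Determinant.det A"
    then obtain b' P' A' where "quotient_basis N T n b' P' A'" "\<delta> = Determinant.det A'"
      using T unfolding quotient_basis_def by auto
    then show "\<delta> = Determinant.det A"
      using quotient_basis_det_unique[OF N T T' NT] B by metis
  qed
qed

lemma sum_single:
  assumes "finite A" "a \<in> A" "\<And>i. i \<in> A \<Longrightarrow> i \<noteq> a \<Longrightarrow> f i = 0"
  shows "sum f A = f a"
  using assms by (simp add: sum.remove[of A a] sum.neutral)

text \<open>The basis vectors \<open>e\<^sub>a\<close> with \<open>S a\<close> represent a basis of the quotient by the kernel.\<close>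

lemma quotient_det_diagonal_shift:
  fixes f :: "nat \<Rightarrow> complex"
  assumes S: "\<And>a. a < n \<Longrightarrow> S a \<Longrightarrow> Suc a < n"
    and c: "\<And>a. a < n \<Longrightarrow> S a \<Longrightarrow> f (Suc a) = c * f a" and "c \<noteq> 0"
  defines "N \<equiv> mat n n (\<lambda>(a, b). if a = Suc b \<and> S b then 1 else 0)"
  shows "quotient_det (diagonal n f) (carrier_vec n) (carrier_vec n \<inter> mat_kernel N) =
    (\<Prod>a | a < n \<and> S a. f a)"
proof -
  define idx where "idx = filter S [0..<n]"
  define b where "b = length idx"
  have idx: "idx ! j < n" "S (idx ! j)" if "j < b" for j
    using nth_mem[of j idx] that by (auto simp: idx_def b_def)
  have dist: "distinct idx" by (simp add: idx_def)
  have ex: "\<exists>j<b. idx ! j = a" if "a < n" "S a" for a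
    using that by (auto simp: idx_def b_def in_set_conv_nth[symmetric])
  define P where "P = mat n b (\<lambda>(a, j). if a = idx ! j then 1 else (0::complex))"
  define A where "A = diagonal b (\<lambda>j. f (idx ! j))"
  have N: "N \<in> carrier_mat n n" and P: "P \<in> carrier_mat n b" and A: "A \<in> carrier_mat b b"
    by (simp_all add: N_def P_def A_def)
  have Nv: "(N *\<^sub>v v) $ Suc a = v $ a" if "v \<in> carrier_vec n" "a < n" "S a" for v a
  proof -
    have "(N *\<^sub>v v) $ Suc a = (\<Sum>i\<in>{0..<n}. (if a = i \<and> S i then 1 else 0) * v $ i)"
      using that S[of a] by (simp add: N_def scalar_prod_def)
    then show ?thesis using that by (simp add: sum_single[of _ a])
  qed
  have Nv0: "(N *\<^sub>v v) $ a = 0" if "v \<in> carrier_vec n" "a < n" "\<nexists>a'. a = Suc a' \<and> S a'" for v a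
    using that by (auto simp: N_def scalar_prod_def intro!: sum.neutral)
  have ker: "v \<in> mat_kernel N \<longleftrightarrow> (\<forall>a<n. S a \<longrightarrow> v $ a = 0)" if v: "v \<in> carrier_vec n" for v
  proof
    assume "v \<in> mat_kernel N"
    then have "N *\<^sub>v v = 0\<^sub>v n" using N by (simp add: mat_kernel)
    then show "\<forall>a<n. S a \<longrightarrow> v $ a = 0"
      using Nv[OF v] S by (metis index_zero_vec(1))
  next
    assume z: "\<forall>a<n. S a \<longrightarrow> v $ a = 0"
    have "N *\<^sub>v v = 0\<^sub>v n"
    proof (rule eq_vecI)
      fix a assume "a < dim_vec (0\<^sub>v n :: complex vec)"
      then have a: "a < n" by simp
      show "(N *\<^sub>v v) $ a = 0\<^sub>v n $ a"
      proof (cases "\<exists>a'. a = Suc a' \<and> S a'")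
        case True
        then show ?thesis using Nv[OF v] z a by auto
      qed (use Nv0[OF v a] a in simp)
    qed (use N in simp)
    then show "v \<in> mat_kernel N" using N v by (simp add: mat_kernel)
  qed
  have Pc: "(P *\<^sub>v u) $ (idx ! j) = u $ j" if "u \<in> carrier_vec b" "j < b" for u j
  proof -
    have "(P *\<^sub>v u) $ (idx ! j) = (\<Sum>i\<in>{0..<b}. (if idx ! j = idx ! i then 1 else 0) * u $ i)"
      using that idx[of j] by (simp add: P_def scalar_prod_def)
    then show ?thesis
      using that dist by (simp add: sum_single[of _ j] nth_eq_iff_index_eq b_def)
  qed
  \<comment> \<open>Modulo ker N only the coordinates selected by S count, and there
    \<open>P *\<^sub>v u\<close> has the entries of u.\<close>
  have kerP: "v - P *\<^sub>v u \<in> mat_kernel N \<longleftrightarrow> (\<forall>j<b. v $ (idx ! j) = u $ j)"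
    if v: "v \<in> carrier_vec n" and u: "u \<in> carrier_vec b" for v u
  proof -
    have "v - P *\<^sub>v u \<in> carrier_vec n" using v u P by auto
    then have "v - P *\<^sub>v u \<in> mat_kernel N \<longleftrightarrow> (\<forall>a<n. S a \<longrightarrow> v $ a = (P *\<^sub>v u) $ a)"
      using ker v u P by auto
    also have "\<dots> \<longleftrightarrow> (\<forall>j<b. v $ (idx ! j) = u $ j)"
      using ex idx Pc[OF u] by metis
    finally show ?thesis .
  qed
  have "\<exists>!u. u \<in> carrier_vec b \<and> v - P *\<^sub>v u \<in> mat_kernel N" if v: "v \<in> carrier_vec n" for v
  proof (rule ex1I)
    show "vec b (\<lambda>j. v $ (idx ! j)) \<in> carrier_vec b \<and>
      v - P *\<^sub>v vec b (\<lambda>j. v $ (idx ! j)) \<in> mat_kernel N"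
      using kerP[OF v] by simp
    fix u assume "u \<in> carrier_vec b \<and> v - P *\<^sub>v u \<in> mat_kernel N"
    then show "u = vec b (\<lambda>j. v $ (idx ! j))"
      using kerP[OF v] by auto
  qed
  moreover have "diagonal n f *\<^sub>v col P j - P *\<^sub>v col A j \<in> mat_kernel N" if j: "j < b" for j
  proof -
    have v: "diagonal n f *\<^sub>v col P j \<in> carrier_vec n" and u: "col A j \<in> carrier_vec b"
      using A j mult_mat_vec_carrier[OF diagonal_carrier, of "col P j" n f] P by auto
    have "(diagonal n f *\<^sub>v col P j) $ (idx ! i) = col A j $ i" if i: "i < b" for i
    proof -
      have "(diagonal n f *\<^sub>v col P j) $ (idx ! i) = (diagonal n f * P) $$ (idx ! i, j)"
        using P j idx[OF i] by (simp add: diagonal_def)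
      also have "\<dots> = (\<Sum>l\<in>{0..<n}. (if idx ! i = l then f (idx ! i) else 0) * P $$ (l, j))"
        using P j idx[OF i] by (simp add: diagonal_def scalar_prod_def)
      also have "\<dots> = f (idx ! i) * P $$ (idx ! i, j)"
        using idx[OF i] by (simp add: sum_single[of _ "idx ! i"])
      also have "\<dots> = col A j $ i"
        using idx[OF i] i j dist
        by (auto simp: P_def A_def diagonal_def nth_eq_iff_index_eq b_def)
      finally show ?thesis .
    qed
    then show ?thesis using kerP[OF v u] by blast
  qed
  ultimately have B: "quotient_basis N (diagonal n f) n b P A"
    using P A by (simp add: quotient_basis_def)
  \<comment> \<open>The required \<open>T'\<close>: at entry (b + 1, b) the left side is f b and the
    right side is f (b + 1) / c, equal by the recursion for f.\<close>
  have "N * diagonal n f = diagonal n (\<lambda>a. f a / c) * N"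
  proof (rule eq_matI)
    fix a b assume "a < dim_row (diagonal n (\<lambda>a. f a / c) * N)"
      "b < dim_col (diagonal n (\<lambda>a. f a / c) * N)"
    then have ab: "a < n" "b < n" using N by (simp_all add: diagonal_def)
    then show "(N * diagonal n f) $$ (a, b) = (diagonal n (\<lambda>a. f a / c) * N) $$ (a, b)"
      unfolding index_diagonal_mult[OF N ab] using c[of b] \<open>c \<noteq> 0\<close> by (auto simp: N_def)
  qed (use N in \<open>auto simp: diagonal_def\<close>)
  then have "quotient_det (diagonal n f) (carrier_vec n) (carrier_vec n \<inter> mat_kernel N) =
    Determinant.det A"
    using quotient_det_eqI[OF N diagonal_carrier diagonal_carrier _ B] by blast
  also have "\<dots> = (\<Prod>j<b. f (idx ! j))"
    by (simp add: A_def det_diagonal)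
  also have "\<dots> = (\<Prod>a\<in>set idx. f a)"
    using prod.reindex_bij_betw[OF bij_betw_nth[OF dist refl refl], of f] by (simp add: b_def)
  also have "set idx = {a. a < n \<and> S a}"
    by (auto simp: idx_def)
  finally show ?thesis .
qed

section \<open>Topology and Haar measure\<close>

lemma Metric_space_vdist: "Metric_space S vdist"
proof
  fix x y z :: 'a
  show "0 \<le> vdist x y" by (simp add: vdist_def vabs_nonneg)
  show "vdist x y = vdist y x" by (simp add: vdist_def vabs_minus_commute)
  show "vdist x y = 0 \<longleftrightarrow> x = y" by (simp add: vdist_def vabs_eq_0_iff)
  show "vdist x z \<le> vdist x y + vdist y z"
    using vabs_ultrametric[of "x - y" "y - z"] vabs_nonneg[of "x - y"] vabs_nonneg[of "y - z"]
    by (simp add: vdist_def)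
qed

lemma openin_vdistI:
  assumes "U \<subseteq> S" "\<And>x. x \<in> U \<Longrightarrow> \<exists>r>0. \<forall>y\<in>S. vabs (x - y) < r \<longrightarrow> y \<in> U"
  shows "openin (Metric_space.mtopology S vdist) U"
proof -
  interpret Metric_space S vdist by (rule Metric_space_vdist)
  show ?thesis
    unfolding openin_mtopology
  proof (intro conjI allI impI)
    fix x assume "x \<in> U"
    then obtain r where "r > 0" "\<forall>y\<in>S. vabs (x - y) < r \<longrightarrow> y \<in> U"
      using assms(2) by blast
    then show "\<exists>r>0. mball x r \<subseteq> U"
      by (intro exI[of _ r]) (auto simp: vdist_def)
  qed (rule assms(1))
qed

text \<open>On the ball of radius |x| around x the absolute value is constant, so any function of
  the valuation is locally constant.\<close>

lemma continuous_map_vdist_val: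
  fixes f :: "int \<Rightarrow> complex"
  shows "continuous_map (Metric_space.mtopology (L - {0}) vdist) euclidean (\<lambda>x. f (val L x))"
proof -
  interpret Metric_space "L - {0}" vdist by (rule Metric_space_vdist)
  have "openin mtopology {x \<in> L - {0}. f (val L x) \<in> U}" for U
  proof (rule openin_vdistI)
    fix x assume x: "x \<in> {x \<in> L - {0}. f (val L x) \<in> U}"
    have "y \<in> {x \<in> L - {0}. f (val L x) \<in> U}" if "y \<in> L - {0}" "vabs (x - y) < vabs x" for y
      using val_cong[OF vabs_eq_of_close[OF that(2)], of L] that(1) x by simp
    then show "\<exists>r>0. \<forall>y\<in>L - {0}. vabs (x - y) < r \<longrightarrow> y \<in> {x \<in> L - {0}. f (val L x) \<in> U}"
      using x by (intro exI[of _ "vabs x"] conjI ballI impI) (simp_all add: vabs_pos_iff)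
  qed auto
  then show ?thesis
    by (simp add: continuous_map_def)
qed

section \<open>Measurability and the volume of the units\<close>

context
  fixes L :: "'a::nonarch_valued_field set" and \<mu>
  assumes L: "nonarch_local_field L" and \<mu>: "haar_measure L \<mu>"
begin

lemma haar_measurable:
  "openin (Metric_space.mtopology L vdist) U \<Longrightarrow> U \<in> sets \<mu>"
  using \<mu> by (auto simp: haar_measure_def intro: sigma_sets.Basic)

lemma haar_translate:
  "x \<in> L \<Longrightarrow> A \<in> sets \<mu> \<Longrightarrow> emeasure \<mu> ((\<lambda>y. x + y) ` A) = emeasure \<mu> A"
  using \<mu> by (simp add: haar_measure_def)

lemma unit_group_measurable: "unit_group L \<in> sets \<mu>"
proof (rule haar_measurable, rule openin_vdistI)
  fix x assume x: "x \<in> unit_group L"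
  then show "\<exists>r>0. \<forall>y\<in>L. vabs (x - y) < r \<longrightarrow> y \<in> unit_group L"
    using vabs_eq_of_close[of x] by (intro exI[of _ 1]) (auto simp: unit_group_def)
qed (auto simp: unit_group_def)

lemma ball_measurable: "{y \<in> L. vabs (y - x) < 1} \<in> sets \<mu>"
proof (rule haar_measurable, rule openin_vdistI)
  fix z assume z: "z \<in> {y \<in> L. vabs (y - x) < 1}"
  then show "\<exists>r>0. \<forall>y\<in>L. vabs (z - y) < r \<longrightarrow> y \<in> {y \<in> L. vabs (y - x) < 1}"
    using vabs_diff_trans[of _ z 1 x] by (intro exI[of _ 1]) (auto simp: vabs_minus_commute)
qed auto

lemma ring_of_integers_measurable: "ring_of_integers L \<in> sets \<mu>"
proof (rule haar_measurable, rule openin_vdistI)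
  fix z assume z: "z \<in> ring_of_integers L"
  then show "\<exists>r>0. \<forall>y\<in>L. vabs (z - y) < r \<longrightarrow> y \<in> ring_of_integers L"
    using vabs_le_1_of_close[of z] by (intro exI[of _ 1]) (auto simp: ring_of_integers_def)
qed (auto simp: ring_of_integers_def)

lemma emeasure_ball:
  assumes "x \<in> L"
  shows "emeasure \<mu> {y \<in> L. vabs (y - x) < 1} = emeasure \<mu> {y \<in> L. vabs y < 1}"
proof -
  have sub: "is_subfield L" using L by (simp add: nonarch_local_field_def)
  have "(\<lambda>y. x + y) ` {y \<in> L. vabs y < 1} = {y \<in> L. vabs (y - x) < 1}"
  proof (intro equalityI subsetI)
    fix y assume y: "y \<in> {y \<in> L. vabs (y - x) < 1}"
    then have "y - x \<in> L"
      using sub assms by (metis (no_types, lifting) is_subfield_def mem_Collect_eq uminus_add_conv_diff add.commute)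
    then show "y \<in> (\<lambda>y. x + y) ` {y \<in> L. vabs y < 1}"
      using y by (intro image_eqI[of _ _ "y - x"]) auto
  qed (use sub assms in \<open>auto simp: is_subfield_def\<close>)
  then show ?thesis
    using haar_translate[OF assms ball_measurable[of 0]] by simp
qed

text \<open>The ring of integers is the union of finitely many translates of the maximal ideal, and
  one of these translates consists of units.\<close>

lemma measure_unit_group_pos: "0 < measure \<mu> (unit_group L)"
proof -
  have fin: "finite (residue_field L)" and sub: "is_subfield L"
    using L by (auto simp: nonarch_local_field_def)
  let ?m = "{y \<in> L. vabs y < 1}"
  obtain R where R: "\<And>C. C \<in> residue_field L \<Longrightarrow> R C \<in> ring_of_integers L \<and>
      C = residue_rel L `` {R C}"
    using residue_reps[of L] by metis
  have "ring_of_integers L \<subseteq> (\<Union>C\<in>residue_field L. {y \<in> L. vabs (y - R C) < 1})"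
  proof
    fix x assume x: "x \<in> ring_of_integers L"
    define C where "C = residue_rel L `` {x}"
    have C: "C \<in> residue_field L"
      using x by (simp add: C_def residue_field_eq quotientI)
    have "x \<in> C"
      using x by (simp add: C_def residue_rel_def)
    then have "(R C, x) \<in> residue_rel L"
      using R[OF C] by blast
    then show "x \<in> (\<Union>C\<in>residue_field L. {y \<in> L. vabs (y - R C) < 1})"
      using C x by (auto simp: residue_rel_def ring_of_integers_def vabs_minus_commute)
  qed
  then have "emeasure \<mu> (ring_of_integers L) \<le>
      emeasure \<mu> (\<Union>C\<in>residue_field L. {y \<in> L. vabs (y - R C) < 1})"
    by (rule emeasure_mono) (use fin ball_measurable in auto)
  also have "\<dots> \<le> (\<Sum>C\<in>residue_field L. emeasure \<mu> {y \<in> L. vabs (y - R C) < 1})"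
    by (rule emeasure_subadditive_finite) (use fin ball_measurable in auto)
  also have "\<dots> = (\<Sum>C\<in>residue_field L. emeasure \<mu> ?m)"
    using R emeasure_ball by (intro sum.cong) (auto simp: ring_of_integers_def)
  finally have "emeasure \<mu> ?m \<noteq> 0"
    using \<mu> by (auto simp: haar_measure_def)
  moreover have one: "1 \<in> L" using sub by (simp add: is_subfield_def)
  then have "emeasure \<mu> {y \<in> L. vabs (y - 1) < 1} = emeasure \<mu> ?m"
    by (rule emeasure_ball)
  moreover have "emeasure \<mu> {y \<in> L. vabs (y - 1) < 1} \<le> emeasure \<mu> (unit_group L)"
    by (rule emeasure_mono[OF _ unit_group_measurable])
      (use vabs_eq_of_close[of 1] in \<open>auto simp: unit_group_def vabs_minus_commute\<close>)
  ultimately have "0 < emeasure \<mu> (unit_group L)"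
    by (metis not_gr_zero le_zero_eq)
  \<comment> \<open>Finiteness matters, since \<open>measure\<close> assigns 0 to sets of infinite
    measure.\<close>
  moreover have "emeasure \<mu> (unit_group L) \<le> emeasure \<mu> (ring_of_integers L)"
    by (rule emeasure_mono[OF _ ring_of_integers_measurable])
      (auto simp: unit_group_def ring_of_integers_def)
  then have "emeasure \<mu> (unit_group L) < \<infinity>"
    using \<mu> by (auto simp: haar_measure_def)
  ultimately show ?thesis
    by (simp add: measure_def enn2real_positive_iff)
qed

lemma gauss_integral_unramified:
  assumes "\<And>u. u \<in> unit_group L \<Longrightarrow> \<eta> u = 1" "\<And>u. u \<in> unit_group L \<Longrightarrow> \<psi> u = 1"
  shows "gauss_integral L \<mu> \<eta> \<psi> 1 = complex_of_real (measure \<mu> (unit_group L))"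
proof -
  have "gauss_integral L \<mu> \<eta> \<psi> 1 = (LINT u:unit_group L|\<mu>. 1)"
    unfolding gauss_integral_def
    using unit_group_measurable assms by (intro set_lebesgue_integral_cong) auto
  also have "\<dots> = (LINT u|\<mu>. complex_of_real (indicator (unit_group L) u))"
    unfolding set_lebesgue_integral_def by (simp add: scaleR_conv_of_real)
  also have "\<dots> = complex_of_real (measure \<mu> (unit_group L))"
    using sets.sets_into_space[OF unit_group_measurable]
    by (simp add: Int_absorb2)
  finally show ?thesis .
qed

end

section \<open>Sums of unramified characters\<close>

lemma quasicharacter_unramified:
  assumes "nonarch_local_field L" "c \<noteq> 0"
  shows "quasicharacter L (\<lambda>x. c powi val L x)"
  using assms continuous_map_vdist_val[of L "\<lambda>v. c powi v"]
  by (auto simp: quasicharacter_def val_mult power_int_add)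

lemma artin_exponent_unramified:
  assumes "nonarch_local_field L"
  shows "artin_exponent L (\<lambda>x. c powi val L x) = 0"
proof -
  have "\<forall>u\<in>higher_units L 0. c powi val L u = 1"
    using val_1[OF assms] by (simp add: higher_units_def unit_group_def)
  then show ?thesis
    unfolding artin_exponent_def by (intro Least_eq_0)
qed

lemma finite_ext_refl: "is_subfield K \<Longrightarrow> finite_ext K K"
  unfolding finite_ext_def
  by (intro conjI exI[of _ "{1}"]) (auto simp: is_subfield_def intro: exI[of _ "\<lambda>_. _"])

text \<open>At level 0 the scaling factor is p^0 = 1; a uniformizer must exist for the level
  condition to say anything.\<close>

lemma additive_character_trivial_on_integers:
  assumes L: "nonarch_local_field L" and \<psi>: "has_conductor L \<psi> 0" and x: "x \<in> ring_of_integers L"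
  shows "\<psi> x = 1"
  using assms by (auto simp: has_conductor_def trivial_on_level_def nonarch_local_field_def)

context
  fixes L :: "'a::nonarch_valued_field set" and A
  assumes L: "nonarch_local_field L" and A: "artin_map L A" and sep: "separable_closure_of L"
begin

lemma weil_rep_diagonal:
  assumes "\<And>a. a < n \<Longrightarrow> c a \<noteq> 0"
  shows "weil_rep L n (\<lambda>w. diagonal n (\<lambda>a. c a powi val L (A w)))"
  unfolding weil_rep_def
proof (intro conjI ballI allI impI)
  show "diagonal n (\<lambda>a. c a powi val L (A id)) = 1\<^sub>m n"
    using val_artin_id[OF L A] by (simp add: diagonal_1)
  fix v w assume "v \<in> weil_group L" "w \<in> weil_group L"
  then show "diagonal n (\<lambda>a. c a powi val L (A (v \<circ> w))) =
    diagonal n (\<lambda>a. c a powi val L (A v)) * diagonal n (\<lambda>a. c a powi val L (A w))"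
    using val_artin_comp[OF L A] assms
    by (auto simp: diagonal_mult power_int_add intro!: diagonal_cong)
next
  fix i j
  show "continuous_map (weil_topology L) euclidean
    (\<lambda>w. diagonal n (\<lambda>a. c a powi val L (A w)) $$ (i, j))"
  proof (rule continuous_map_weil_topology[OF L])
    fix w \<tau> assume w: "w \<in> weil_group L" and \<tau>: "\<tau> \<in> inertia_group L"
    then have "val L (A (w \<circ> \<tau>)) = val L (A w)"
      using val_artin_comp[OF L A w] val_artin_inertia[OF L A sep \<tau>] inertia_group_subset[of L]
      by auto
    then show "diagonal n (\<lambda>a. c a powi val L (A (w \<circ> \<tau>))) $$ (i, j) =
      diagonal n (\<lambda>a. c a powi val L (A w)) $$ (i, j)"
      by simp
  qed
qed simp

end

lemma diag_block_mat_two: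
  assumes "A \<in> carrier_mat m m" "B \<in> carrier_mat l l"
  shows "diag_block_mat [A, B] = four_block_mat A (0\<^sub>m m l) (0\<^sub>m l m) B"
  using diag_block_mat_snoc[OF assms diag_block_mat_singleton] by (simp only: append_Cons append_Nil)

lemma langlands_epsilon_nonzero:
  assumes "langlands_epsilon K art \<mu> eps" "finite_ext K L"
    "nontrivial_additive_character L \<psi>" "weil_rep L n \<rho>"
  shows "eps L \<psi> n \<rho> \<noteq> 0"
  using assms(1)[unfolded langlands_epsilon_def, THEN conjunct1] assms(2-) by blast

lemma langlands_epsilon_add:
  assumes "langlands_epsilon K art \<mu> eps" "finite_ext K L"
    "nontrivial_additive_character L \<psi>" "weil_rep L n \<rho>" "weil_rep L n' \<rho>'"
  shows "eps L \<psi> (n + n') (\<lambda>w. diag_block_mat [\<rho> w, \<rho>' w]) = eps L \<psi> n \<rho> * eps L \<psi> n' \<rho>'"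
  using assms(1)[unfolded langlands_epsilon_def, THEN conjunct2, THEN conjunct2, THEN conjunct1]
    assms(2-) by blast

lemma langlands_epsilon_character:
  assumes "langlands_epsilon K art \<mu> eps" "finite_ext K L"
    "nontrivial_additive_character L \<psi>" "has_conductor L \<psi> m" "quasicharacter L \<eta>"
    "c \<in> L - {0}" "val L c = int (artin_exponent L \<eta>) + m"
  shows "eps L \<psi> 1 (\<lambda>w. mat 1 1 (\<lambda>_. \<eta> (art L w))) =
    \<eta> c * (gauss_integral L (\<mu> L) \<eta> \<psi> c / complex_of_real (cmod (gauss_integral L (\<mu> L) \<eta> \<psi> c)))"
  using assms(1)[unfolded langlands_epsilon_def, THEN conjunct2, THEN conjunct2, THEN conjunct2,
      THEN conjunct2] assms(2-) by blast

text \<open>Additivity peels off one character at a time. Each has epsilon factor 1 by the formula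
  at c = 1, where the Gauss integral is a positive real number.\<close>

lemma eps_unramified:
  fixes K :: "'a::nonarch_valued_field set"
  assumes K: "nonarch_local_field K" and sep: "separable_closure_of K"
    and A: "artin_map K (art K)" and \<mu>: "haar_measure K (\<mu> K)"
    and eps: "langlands_epsilon K art \<mu> eps"
    and \<psi>: "nontrivial_additive_character K \<psi>" "has_conductor K \<psi> 0"
    and c: "\<And>a. a < n \<Longrightarrow> c a \<noteq> 0"
  shows "eps K \<psi> n (\<lambda>w. diagonal n (\<lambda>a. c a powi val K (art K w))) = 1"
  using c
proof (induction n)
  have sub: "is_subfield K" using K by (simp add: nonarch_local_field_def)
  note add = langlands_epsilon_add[OF eps finite_ext_refl[OF sub] \<psi>(1)]
  note nz = langlands_epsilon_nonzero[OF eps finite_ext_refl[OF sub] \<psi>(1)]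
  {
    case 0
    let ?\<rho> = "\<lambda>w. diagonal 0 (\<lambda>a. c a powi val K (art K w))"
    have W: "weil_rep K 0 ?\<rho>" by (rule weil_rep_diagonal[OF K A sep]) simp
    \<comment> \<open>The zero representation is its own double, so its epsilon factor is
      idempotent; being nonzero, it is 1.\<close>
    have "diag_block_mat [?\<rho> w, ?\<rho> w] = ?\<rho> w" for w
      unfolding diag_block_mat_two[OF diagonal_carrier diagonal_carrier]
      by (rule eq_matI) (auto simp: diagonal_def)
    then show ?case using add[OF W W] nz[OF W] by simp
  next
    case (Suc n)
    let ?\<eta> = "\<lambda>x. c n powi val K x"
    have cn: "c n \<noteq> 0" using Suc by simp
    have W: "weil_rep K n (\<lambda>w. diagonal n (\<lambda>a. c a powi val K (art K w)))"
      by (rule weil_rep_diagonal[OF K A sep]) (use Suc in simp)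
    have D1: "mat 1 1 (\<lambda>_. x) = diagonal 1 (\<lambda>_. x)" for x
      by (rule eq_matI) (auto simp: diagonal_def)
    have W1: "weil_rep K 1 (\<lambda>w. mat 1 1 (\<lambda>_. ?\<eta> (art K w)))"
      unfolding D1 by (rule weil_rep_diagonal[OF K A sep]) (rule cn)
    have "diag_block_mat [diagonal n (\<lambda>a. c a powi val K (art K w)), mat 1 1 (\<lambda>_. ?\<eta> (art K w))] =
      diagonal (Suc n) (\<lambda>a. c a powi val K (art K w))" for w
      unfolding D1 diag_block_mat_two[OF diagonal_carrier diagonal_carrier]
      by (rule eq_matI) (auto simp: diagonal_def less_Suc_eq)
    then have "eps K \<psi> (Suc n) (\<lambda>w. diagonal (Suc n) (\<lambda>a. c a powi val K (art K w))) =
      eps K \<psi> 1 (\<lambda>w. mat 1 1 (\<lambda>_. ?\<eta> (art K w)))"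
      using add[OF W W1] Suc by simp
    also have "\<dots> = ?\<eta> 1 * (gauss_integral K (\<mu> K) ?\<eta> \<psi> 1 /
        complex_of_real (cmod (gauss_integral K (\<mu> K) ?\<eta> \<psi> 1)))"
    proof -
      have "1 \<in> K - {0}" using sub by (simp add: is_subfield_def)
      moreover have "val K 1 = int (artin_exponent K ?\<eta>) + 0"
        using artin_exponent_unramified[OF K] val_1[OF K, of 1] by simp
      ultimately show ?thesis
        by (rule langlands_epsilon_character[OF eps finite_ext_refl[OF sub] \<psi>
              quasicharacter_unramified[OF K cn]])
    qed
    also have "gauss_integral K (\<mu> K) ?\<eta> \<psi> 1 = complex_of_real (measure (\<mu> K) (unit_group K))"
      by (rule gauss_integral_unramified[OF K \<mu>])
        (use val_1[OF K] additive_character_trivial_on_integers[OF K \<psi>(2)] in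
          \<open>auto simp: unit_group_def ring_of_integers_def\<close>)
    finally show ?case
      using measure_unit_group_pos[OF K \<mu>] val_1[OF K, of 1] by simp
  }
qed

section \<open>Twisted special representations\<close>

text \<open>The eigenvalue of a geometric Frobenius, whose norm is 1/q, on the i-th vector of block
  j: (1/q)^(s_j + i).\<close>

definition sp_eigenvalue :: "nat \<Rightarrow> (nat \<Rightarrow> complex) \<Rightarrow> nat \<times> nat \<Rightarrow> complex" where
  "sp_eigenvalue q s = (\<lambda>(j, i). of_nat q powr (- s j) / of_nat q ^ i)"

lemma additive_to_multiplicative_powi:
  fixes h :: "int \<Rightarrow> 'b::field"
  assumes "\<And>a b. h (a + b) = h a * h b" "h 0 = 1"
  shows "h v = h 1 powi v"
proof -
  have inv: "h 1 \<noteq> 0" using assms(1)[of 1 "-1"] assms(2) by auto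
  show ?thesis
  proof (induction v rule: int_induct[where k = 0])
    case (step1 i)
    then show ?case using assms(1) inv by (simp add: power_int_add)
  next
    case (step2 i)
    have "h i = h (i - 1) * h 1" using assms(1)[of "i - 1" 1] by simp
    then show ?case using step2 inv by (simp add: power_int_diff field_simps)
  qed (simp add: assms(2))
qed

text \<open>Complex \<open>powr\<close> is multiplicative in the base on nonnegative reals. Hence
  the left side is a homomorphism in v, and it suffices to compute it at v = 1.\<close>

lemma powi_powr_eq:
  assumes q: "0 < q"
  shows "complex_of_real (real q powi (- v)) powr s * complex_of_real (real q powi (- v)) ^ i =
    (of_nat q powr (- s) / of_nat q ^ i) powi v"
proof -
  define h where "h = (\<lambda>v. complex_of_real (real q powi (- v)) powr s *
    complex_of_real (real q powi (- v)) ^ i)"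
  have "h (a + b) = h a * h b" for a b
  proof -
    have "complex_of_real (real q powi (- (a + b))) =
        complex_of_real (real q powi (- a)) * complex_of_real (real q powi (- b))"
      using q by (simp add: power_int_add[symmetric] flip: of_real_mult)
    moreover have "(complex_of_real (real q powi (- a)) * complex_of_real (real q powi (- b))) powr s =
        complex_of_real (real q powi (- a)) powr s * complex_of_real (real q powi (- b)) powr s"
      by (rule powr_times_real) (simp_all only: Reals_of_real Re_complex_of_real, simp_all)
    ultimately show ?thesis
      unfolding h_def by (simp only: power_mult_distrib mult_ac)
  qed
  moreover have "h 0 = 1" by (simp add: h_def)
  ultimately have "h v = h 1 powi v" by (rule additive_to_multiplicative_powi)
  moreover have "h 1 = of_nat q powr (- s) / of_nat q ^ i"
  proof -
    have "complex_of_real (real q) powr s * complex_of_real (inverse (real q)) powr s =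
        (complex_of_real (real q) * complex_of_real (inverse (real q))) powr s"
      by (rule powr_times_real[symmetric]) (simp_all only: Reals_of_real Re_complex_of_real, simp_all)
    also have "\<dots> = 1" using q by (simp flip: of_real_mult)
    finally have "complex_of_real (inverse (real q)) powr s = of_nat q powr (- s)"
      by (simp add: powr_minus inverse_unique)
    then show ?thesis
      unfolding h_def by (simp add: field_simps power_inverse power_int_minus)
  qed
  ultimately show ?thesis by (simp add: h_def)
qed

lemma sum_rep_eq:
  assumes "0 < residue_card K"
  shows "sum_rep K A k d s w = diagonal (length (block_index k d))
    (\<lambda>a. sp_eigenvalue (residue_card K) s (block_index k d ! a) powi val K (A w))"
proof -
  have "omega_char K A (s j) w \<cdot>\<^sub>m sp_rep K A (d j) w =
    diagonal (d j) (\<lambda>i. sp_eigenvalue (residue_card K) s (j, i) powi val K (A w))" for j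
    using powi_powr_eq[OF assms, of "val K (A w)" "s j"]
    by (intro eq_matI) (auto simp: diagonal_def sp_rep_def omega_char_def weil_norm_def sp_eigenvalue_def)
  then show ?thesis
    unfolding sum_rep_def using diag_block_mat_diagonal by simp
qed

lemma sp_eigenvalue_succ:
  assumes "b < length (block_index k d)" "in_block_succ k d b"
  shows "sp_eigenvalue q s (block_index k d ! Suc b) =
    (1 / of_nat q) * sp_eigenvalue q s (block_index k d ! b)"
  using block_index_succ[OF assms] by (cases "block_index k d ! b") (auto simp: sp_eigenvalue_def)

lemma sp_eigenvalue_nonzero: "0 < q \<Longrightarrow> sp_eigenvalue q s p \<noteq> 0"
  by (cases p) (simp add: sp_eigenvalue_def)

lemma prod_sp_eigenvalue:
  assumes "0 < q"
  shows "(\<Prod>i<m. - sp_eigenvalue q s (j, i)) =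
    (- 1) ^ m * of_nat q powi (- (int m * (int m - 1) div 2)) * (of_nat q powr (- s j)) ^ m"
proof (induction m)
  case (Suc m)
  \<comment> \<open>Writing the increment as a multiple of 2 lets it leave the integer division
    without a parity argument.\<close>
  have "int (Suc m) * (int (Suc m) - 1) = int m * (int m - 1) + int m * 2"
    by (simp add: algebra_simps)
  then have e: "- (int (Suc m) * (int (Suc m) - 1) div 2) = - (int m * (int m - 1) div 2) - int m"
    by simp
  have "of_nat q powi (- (int (Suc m) * (int (Suc m) - 1) div 2)) =
    of_nat q powi (- (int m * (int m - 1) div 2)) / (of_nat q ^ m :: complex)"
    unfolding e using assms by (simp add: power_int_diff)
  then show ?case
    using Suc by (simp add: sp_eigenvalue_def)
qed simp

context
  fixes K :: "'a::nonarch_valued_field set" and A :: "('a \<Rightarrow> 'a) \<Rightarrow> 'a"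
  assumes K: "nonarch_local_field K" and A: "artin_map K A" and sep: "separable_closure_of K"
begin

text \<open>At a nonzero entry of N, conjugation multiplies by the ratio of successive eigenvalues,
  1/q, raised to the valuation of the Artin image, which is the norm of w.\<close>

lemma weil_deligne_rep_sum:
  "weil_deligne_rep K A (\<Sum>j<k. d j) (sum_rep K A k d s) (sum_nil k d)"
proof -
  define n where "n = length (block_index k d)"
  define c where "c = (\<lambda>a. sp_eigenvalue (residue_card K) s (block_index k d ! a))"
  have q: "0 < residue_card K" using residue_card_ge_2[OF K] by simp
  have c0: "c a \<noteq> 0" for a using sp_eigenvalue_nonzero[OF q] by (simp add: c_def)
  have \<rho>: "sum_rep K A k d s = (\<lambda>w. diagonal n (\<lambda>a. c a powi val K (A w)))"
    using sum_rep_eq[OF q] by (simp add: c_def n_def fun_eq_iff)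
  let ?N = "sum_nil k d"
  have N: "?N \<in> carrier_mat n n" by (simp add: sum_nil_eq n_def)
  have entry: "?N $$ (a, b) = (if a = Suc b \<and> in_block_succ k d b then 1 else 0)"
    if "a < n" "b < n" for a b
    using that by (simp add: sum_nil_eq n_def)
  have rel: "sum_rep K A k d s w * ?N * sum_rep K A k d s (inv_into UNIV w) =
    complex_of_real (weil_norm K A w) \<cdot>\<^sub>m ?N" if w: "w \<in> weil_group K" for w
    unfolding \<rho>
  proof (rule eq_matI)
    fix a b
    assume "a < dim_row (complex_of_real (weil_norm K A w) \<cdot>\<^sub>m ?N)"
      "b < dim_col (complex_of_real (weil_norm K A w) \<cdot>\<^sub>m ?N)"
    then have ab: "a < n" "b < n" using N by auto
    let ?v = "val K (A w)"
    have "(diagonal n (\<lambda>a. c a powi ?v) * ?N *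
        diagonal n (\<lambda>a. c a powi val K (A (inv_into UNIV w)))) $$ (a, b) =
        c a powi ?v * ?N $$ (a, b) * c b powi (- ?v)"
      using index_diagonal_mult(2)[OF mult_carrier_mat[OF diagonal_carrier N] ab]
        index_diagonal_mult(1)[OF N ab] val_artin_inv[OF K A w] by simp
    also have "\<dots> = complex_of_real (weil_norm K A w) * ?N $$ (a, b)"
    proof (cases "a = Suc b \<and> in_block_succ k d b")
      case True
      then have "c a = 1 / of_nat (residue_card K) * c b"
        using sp_eigenvalue_succ ab by (simp add: c_def n_def)
      then have "c a powi ?v = inverse (of_nat (residue_card K) powi ?v) * c b powi ?v"
        by (simp add: power_int_divide_distrib field_simps)
      then show ?thesis
        using c0[of b] entry[OF ab] True by (simp add: weil_norm_def power_int_minus)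
    qed (auto simp: entry[OF ab])
    finally show "(diagonal n (\<lambda>a. c a powi ?v) * ?N *
        diagonal n (\<lambda>a. c a powi val K (A (inv_into UNIV w)))) $$ (a, b) =
        (complex_of_real (weil_norm K A w) \<cdot>\<^sub>m ?N) $$ (a, b)"
      using N ab by simp
  qed (use N in \<open>auto simp: diagonal_def\<close>)
  have "weil_rep K n (sum_rep K A k d s)"
    unfolding \<rho> using weil_rep_diagonal[OF K A sep] c0 by blast
  moreover have "\<exists>l. ?N ^\<^sub>m l = 0\<^sub>m n n"
    using strictly_lower_triangular_nilpotent[OF N] entry by auto
  ultimately show ?thesis
    using N rel by (simp add: weil_deligne_rep_def n_def length_block_index)
qed

lemma quotient_det_sum_rep:
  fixes s :: "nat \<Rightarrow> complex"
  assumes \<Phi>: "geometric_frobenius K \<Phi>" and d: "\<And>j. j < k \<Longrightarrow> 1 \<le> d j"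
    and n: "n = (\<Sum>j<k. d j)"
  defines "\<rho> \<equiv> sum_rep K A k d s"
  shows "quotient_det (- \<rho> \<Phi>) (invariants n \<rho> (inertia_group K))
      (invariants n \<rho> (inertia_group K) \<inter> mat_kernel (sum_nil k d)) =
    (\<Prod>j<k. \<Prod>i<d j - 1. - sp_eigenvalue (residue_card K) s (j, i))"
proof -
  define e where "e = sp_eigenvalue (residue_card K) s"
  define c where "c = (\<lambda>a. e (block_index k d ! a))"
  have nl: "n = length (block_index k d)" by (simp add: n length_block_index)
  have q: "0 < residue_card K" using residue_card_ge_2[OF K] by simp
  have \<rho>: "\<rho> w = diagonal n (\<lambda>a. c a powi val K (A w))" for w
    using sum_rep_eq[OF q] by (simp add: c_def e_def nl \<rho>_def)
  have "\<rho> \<tau> = 1\<^sub>m n" if "\<tau> \<in> inertia_group K" for \<tau>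
    using val_artin_inertia[OF K A sep that] by (simp add: \<rho> diagonal_1)
  then have inv: "invariants n \<rho> (inertia_group K) = carrier_vec n"
    by (auto simp: invariants_def)
  have \<rho>\<Phi>: "- \<rho> \<Phi> = diagonal n (\<lambda>a. - c a)"
    using val_artin_frobenius[OF K A sep \<Phi>]
    by (intro eq_matI) (auto simp: \<rho> diagonal_def)
  have "quotient_det (diagonal n (\<lambda>a. - c a)) (carrier_vec n) (carrier_vec n \<inter> mat_kernel (sum_nil k d)) =
    (\<Prod>a | a < n \<and> in_block_succ k d a. - c a)"
    unfolding sum_nil_eq nl[symmetric]
    by (rule quotient_det_diagonal_shift[where c = "1 / of_nat (residue_card K)"])
      (use block_index_succ sp_eigenvalue_succ q in \<open>auto simp: nl c_def e_def\<close>)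
  \<comment> \<open>Padding with factors 1 gives a product over all basis indices, which can be
    split along the blocks; the padding is removed again within each block.\<close>
  also have "\<dots> = (\<Prod>a<n. if in_block_succ k d a then - c a else 1)"
    by (simp add: prod.inter_filter[symmetric] lessThan_def)
  also have "\<dots> = (\<Prod>a<n. (\<lambda>(j, i). if Suc i < d j then - e (j, i) else 1) (block_index k d ! a))"
    by (intro prod.cong) (auto simp: in_block_succ_def c_def split: prod.splits)
  also have "\<dots> = (\<Prod>j<k. \<Prod>i<d j. if Suc i < d j then - e (j, i) else 1)"
    unfolding nl prod_over_blocks by simp
  also have "\<dots> = (\<Prod>j<k. \<Prod>i<d j - 1. - e (j, i))"
  proof (rule prod.cong)
    fix j assume "j \<in> {..<k}"
    show "(\<Prod>i<d j. if Suc i < d j then - e (j, i) else 1) = (\<Prod>i<d j - 1. - e (j, i))"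
      by (rule prod.mono_neutral_cong_right) auto
  qed simp
  finally show ?thesis
    by (simp only: inv \<rho>\<Phi> e_def)
qed

end

lemma wd_epsilon_sum_rep:
  fixes K :: "'a::nonarch_valued_field set"
  assumes K: "nonarch_local_field K" and sep: "separable_closure_of K"
    and A: "artin_map K (art K)" and \<mu>: "haar_measure K (\<mu> K)"
    and eps: "langlands_epsilon K art \<mu> eps"
    and \<Phi>: "geometric_frobenius K \<Phi>"
    and \<psi>: "nontrivial_additive_character K \<psi>" "has_conductor K \<psi> 0"
    and d: "\<And>j. j < k \<Longrightarrow> 1 \<le> d j" and n: "(\<Sum>j<k. d j) = n"
  defines "q \<equiv> residue_card K"
  shows "wd_epsilon K eps \<Phi> \<psi> n (sum_rep K (art K) k d s) (sum_nil k d) =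
    (\<Prod>j<k. (- 1) ^ (d j - 1) * of_nat q powi (- ((int (d j) - 1) * (int (d j) - 2) div 2))) *
    (\<Prod>j<k. (of_nat q powr (- s j)) ^ (d j - 1))"
proof -
  have q: "0 < residue_card K" using residue_card_ge_2[OF K] by simp
  have "sum_rep K (art K) k d s = (\<lambda>w. diagonal n
      (\<lambda>a. sp_eigenvalue (residue_card K) s (block_index k d ! a) powi val K (art K w)))"
    using sum_rep_eq[OF q] n by (simp add: fun_eq_iff length_block_index)
  then have "eps K \<psi> n (sum_rep K (art K) k d s) = 1"
    using eps_unramified[where K = K and art = art and \<mu> = \<mu>, OF K sep A \<mu> eps \<psi>]
      sp_eigenvalue_nonzero[OF q] by simp
  then have "wd_epsilon K eps \<Phi> \<psi> n (sum_rep K (art K) k d s) (sum_nil k d) =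
    (\<Prod>j<k. \<Prod>i<d j - 1. - sp_eigenvalue (residue_card K) s (j, i))"
    unfolding wd_epsilon_def using quotient_det_sum_rep[OF K A sep \<Phi> d n[symmetric]] by simp
  also have "\<dots> = (\<Prod>j<k. ((- 1) ^ (d j - 1) * of_nat q powi (- ((int (d j) - 1) * (int (d j) - 2) div 2))) *
      (of_nat q powr (- s j)) ^ (d j - 1))"
  proof (rule prod.cong)
    fix j assume "j \<in> {..<k}"
    \<comment> \<open>Natural subtraction is harmless because d_j is at least 1; m = d_j - 1 turns m
      (m - 1) into (d_j - 1)(d_j - 2).\<close>
    then have "int (d j - 1) = int (d j) - 1" using d[of j] by simp
    then show "(\<Prod>i<d j - 1. - sp_eigenvalue (residue_card K) s (j, i)) =
      ((- 1) ^ (d j - 1) * of_nat q powi (- ((int (d j) - 1) * (int (d j) - 2) div 2))) *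
      (of_nat q powr (- s j)) ^ (d j - 1)"
      using prod_sp_eigenvalue[OF q, of s j "d j - 1"] by (simp add: q_def)
  qed simp
  finally show ?thesis by (simp add: prod.distrib)
qed

section \<open>Symmetric monomials on the torus\<close>

text \<open>The exponent depends on the group i but not on the coordinate l, which is the source of
  the symmetry.\<close>

definition torus_monomial ::
  "nat \<Rightarrow> (nat \<Rightarrow> nat) \<Rightarrow> (nat \<Rightarrow> nat) \<Rightarrow> (nat \<Rightarrow> nat \<Rightarrow> complex) \<Rightarrow> complex" where
  "torus_monomial m r e y = (\<Prod>i<m. \<Prod>l<r i. y i l ^ e i)"

lemma torus_monomial_permute:
  assumes "\<And>i. i < m \<Longrightarrow> \<sigma> i permutes {..<r i}"
    and "\<And>i l. i < m \<Longrightarrow> l < r i \<Longrightarrow> y' i l = y i (\<sigma> i l)"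
  shows "torus_monomial m r e y' = torus_monomial m r e y"
  unfolding torus_monomial_def
proof (rule prod.cong)
  fix i assume "i \<in> {..<m}"
  then have i: "i < m" by simp
  have "(\<Prod>l<r i. y' i l ^ e i) = (\<Prod>l<r i. y i (\<sigma> i l) ^ e i)"
    using assms(2)[OF i] by simp
  also have "\<dots> = (\<Prod>l<r i. y i l ^ e i)"
    using prod.permute[OF assms(1)[OF i], of "\<lambda>l. y i l ^ e i"] by (simp add: o_def)
  finally show "(\<Prod>l<r i. y' i l ^ e i) = (\<Prod>l<r i. y i l ^ e i)" .
qed simp

text \<open>By reflexivity \<open>y' i\<close> lies in its own orbit class, hence in that of
  \<open>y i\<close>; this yields the permutations.\<close>

lemma torus_monomial_quotient_cong:
  assumes y: "y \<in> torus_product m r" and y': "y' \<in> torus_product m r"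
    and eq: "quotient_map_product m r y = quotient_map_product m r y'"
  shows "torus_monomial m r e y = torus_monomial m r e y'"
proof -
  have "\<exists>\<sigma>. \<sigma> permutes {..<r i} \<and> y' i = restrict (y i \<circ> \<sigma>) {..<r i}" if i: "i < m" for i
  proof -
    have y'i: "y' i \<in> torus (r i)" using y' i by (auto simp: torus_product_def)
    then have "y' i = restrict (y' i \<circ> id) {..<r i}"
      by (auto simp: torus_def PiE_def extensional_restrict)
    then have "(y' i, y' i) \<in> sym_orbit_rel (r i)"
      using y'i permutes_id unfolding sym_orbit_rel_def by blast
    moreover have "sym_orbit_rel (r i) `` {y i} = sym_orbit_rel (r i) `` {y' i}"
      using fun_cong[OF eq, of i] i by (simp add: quotient_map_product_def)
    ultimately show ?thesis by (auto simp: sym_orbit_rel_def)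
  qed
  then obtain \<sigma> where "\<And>i. i < m \<Longrightarrow> \<sigma> i permutes {..<r i} \<and> y' i = restrict (y i \<circ> \<sigma> i) {..<r i}"
    by metis
  then show ?thesis
    by (intro torus_monomial_permute[of m \<sigma> r y' y, symmetric]) auto
qed

text \<open>F evaluates at an arbitrary preimage, legitimately since the monomial is constant on
  fibres. It is regular because its pullback is a Laurent polynomial with a single exponent.\<close>

lemma scaled_torus_monomial_descends:
  "\<exists>F. regular_on_quotient m r F \<and>
     (\<forall>y\<in>torus_product m r. c * torus_monomial m r e y = F (quotient_map_product m r y))"
proof -
  define F where "F = (\<lambda>Y. c * torus_monomial m r e
    (SOME y. y \<in> torus_product m r \<and> quotient_map_product m r y = Y))"
  have F: "c * torus_monomial m r e y = F (quotient_map_product m r y)" if y: "y \<in> torus_product m r" for y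
  proof -
    define y' where "y' = (SOME z. z \<in> torus_product m r \<and>
      quotient_map_product m r z = quotient_map_product m r y)"
    have y': "y' \<in> torus_product m r \<and> quotient_map_product m r y' = quotient_map_product m r y"
      unfolding y'_def by (rule someI[of _ y]) (simp add: y)
    have "torus_monomial m r e y = torus_monomial m r e y'"
      using torus_monomial_quotient_cong[OF y conjunct1[OF y'] conjunct2[OF y', symmetric]] .
    then show ?thesis by (simp add: F_def y'_def)
  qed
  have "regular_on_quotient m r F"
    unfolding regular_on_quotient_def regular_on_torus_def
  proof (intro exI conjI ballI)
    fix y assume y: "y \<in> torus_product m r"
    show "(F \<circ> quotient_map_product m r) y =
      (\<Sum>f\<in>{\<lambda>i l. int (e i)}. (\<lambda>_. c) f * (\<Prod>i<m. \<Prod>l<r i. y i l powi f i l))"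
      using F[OF y] by (simp add: torus_monomial_def)
  qed simp
  then show ?thesis using F by blast
qed

text \<open>The fibres of d over the values t_i cover the index set because the images agree, and
  are disjoint because t is injective; \<open>g i\<close> enumerates the i-th fibre.\<close>

lemma prod_group_by_value:
  fixes f :: "nat \<Rightarrow> nat \<Rightarrow> 'b::comm_monoid_mult" and m k :: nat
  assumes t: "inj_on t {..<m}" and dt: "d ` {..<k} = t ` {..<m}"
    and g: "\<And>i. i < m \<Longrightarrow> bij_betw (g i) {..<r i} {j. j < k \<and> d j = t i}"
  shows "(\<Prod>j<k. f j (d j)) = (\<Prod>i<m. \<Prod>l<r i. f (g i l) (t i))"
proof -
  have "(\<Prod>j<k. f j (d j)) = (\<Prod>j\<in>(\<Union>i\<in>{..<m}. {j. j < k \<and> d j = t i}). f j (d j))"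
    by (rule prod.cong) (use dt in auto)
  also have "\<dots> = (\<Prod>i<m. \<Prod>j\<in>{j. j < k \<and> d j = t i}. f j (d j))"
    by (rule prod.UNION_disjoint) (use t in \<open>auto simp: inj_on_def\<close>)
  also have "\<dots> = (\<Prod>i<m. \<Prod>l<r i. f (g i l) (t i))"
  proof (rule prod.cong)
    fix i assume "i \<in> {..<m}"
    then have gi: "bij_betw (g i) {..<r i} {j. j < k \<and> d j = t i}" using g by simp
    have "(\<Prod>j\<in>{j. j < k \<and> d j = t i}. f j (d j)) = (\<Prod>j\<in>{j. j < k \<and> d j = t i}. f j (t i))"
      by (rule prod.cong) auto
    also have "\<dots> = (\<Prod>l<r i. f (g i l) (t i))"
      using prod.reindex_bij_betw[OF gi, of "\<lambda>j. f j (t i)"] by simp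
    finally show "(\<Prod>j\<in>{j. j < k \<and> d j = t i}. f j (d j)) = (\<Prod>l<r i. f (g i l) (t i))" .
  qed simp
  finally show ?thesis .
qed

theorem mainTheorem2:
  fixes K :: "'a::nonarch_valued_field set"
    and art :: "'a set \<Rightarrow> ('a \<Rightarrow> 'a) \<Rightarrow> 'a"
    and \<mu> :: "'a set \<Rightarrow> 'a measure"
    and eps :: "'a set \<Rightarrow> ('a \<Rightarrow> complex) \<Rightarrow> nat \<Rightarrow> (('a \<Rightarrow> 'a) \<Rightarrow> complex mat) \<Rightarrow> complex"
    and \<psi> :: "'a \<Rightarrow> complex" and \<Phi> :: "'a \<Rightarrow> 'a"
    and q n k :: nat and d :: "nat \<Rightarrow> nat"
  assumes "nonarch_local_field K" and "separable_closure_of K" and "q = residue_card K"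
    and "\<And>L. finite_ext K L \<Longrightarrow> artin_map L (art L)"
    and "\<And>L. finite_ext K L \<Longrightarrow> haar_measure L (\<mu> L)"
    and "langlands_epsilon K art \<mu> eps"
    and "geometric_frobenius K \<Phi>"
    and "nontrivial_additive_character K \<psi>" and "has_conductor K \<psi> 0"
    and "\<And>j. j < k \<Longrightarrow> d j \<ge> 1" and "(\<Sum>j<k. d j) = n"
  shows
    "(\<forall>s :: nat \<Rightarrow> complex.
        weil_deligne_rep K (art K) n (sum_rep K (art K) k d s) (sum_nil k d) \<and>
        wd_epsilon K eps \<Phi> \<psi> n (sum_rep K (art K) k d s) (sum_nil k d) =
          (\<Prod>j<k. (- 1) ^ (d j - 1) *
             of_nat q powi (- ((int (d j) - 1) * (int (d j) - 2) div 2))) *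
          (\<Prod>j<k. (of_nat q powr (- s j)) ^ (d j - 1))) \<and>
     (\<forall>(m :: nat) (t :: nat \<Rightarrow> nat) (r :: nat \<Rightarrow> nat) (g :: nat \<Rightarrow> nat \<Rightarrow> nat).
        strict_mono_on {..<m} t \<and> d ` {..<k} = t ` {..<m} \<and>
        (\<forall>i<m. bij_betw (g i) {..<r i} {j. j < k \<and> d j = t i}) \<longrightarrow>
        (\<exists>E :: (nat \<Rightarrow> nat \<Rightarrow> complex) \<Rightarrow> complex.
           (\<forall>s :: nat \<Rightarrow> complex.
              wd_epsilon K eps \<Phi> \<psi> n (sum_rep K (art K) k d s) (sum_nil k d) =
                E (\<lambda>i\<in>{..<m}. \<lambda>l\<in>{..<r i}. of_nat q powr (- s (g i l)))) \<and>
           (\<forall>y\<in>torus_product m r. \<forall>\<sigma>. (\<forall>i<m. \<sigma> i permutes {..<r i}) \<longrightarrow>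
              E (\<lambda>i\<in>{..<m}. restrict (y i \<circ> \<sigma> i) {..<r i}) = E y) \<and>
           (\<exists>F. regular_on_quotient m r F \<and>
              (\<forall>y\<in>torus_product m r. E y = F (quotient_map_product m r y)))))"
proof (intro conjI allI impI)
  have sub: "is_subfield K" using assms(1) by (simp add: nonarch_local_field_def)
  note ext = finite_ext_refl[OF sub]
  note eps = wd_epsilon_sum_rep[where K = K and art = art and \<mu> = \<mu> and eps = eps and d = d and k = k,
      OF assms(1,2) assms(4)[OF ext] assms(5)[OF ext] assms(6-9) assms(10) assms(11), folded assms(3)]
  let ?C = "\<Prod>j<k. (- 1) ^ (d j - 1) *
             of_nat q powi (- ((int (d j) - 1) * (int (d j) - 2) div 2)) :: complex"
  fix s
  show "weil_deligne_rep K (art K) n (sum_rep K (art K) k d s) (sum_nil k d)"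
    unfolding assms(11)[symmetric] by (rule weil_deligne_rep_sum[OF assms(1) assms(4)[OF ext] assms(2)])
  show "wd_epsilon K eps \<Phi> \<psi> n (sum_rep K (art K) k d s) (sum_nil k d) =
    ?C * (\<Prod>j<k. (of_nat q powr (- s j)) ^ (d j - 1))"
    by (rule eps)
next
  fix m t r g
  have sub: "is_subfield K" using assms(1) by (simp add: nonarch_local_field_def)
  note ext = finite_ext_refl[OF sub]
  note eps = wd_epsilon_sum_rep[where K = K and art = art and \<mu> = \<mu> and eps = eps and d = d and k = k,
      OF assms(1,2) assms(4)[OF ext] assms(5)[OF ext] assms(6-9) assms(10) assms(11), folded assms(3)]
  let ?C = "\<Prod>j<k. (- 1) ^ (d j - 1) *
             of_nat q powi (- ((int (d j) - 1) * (int (d j) - 2) div 2)) :: complex"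
  \<comment> \<open>The constant depends only on q and d, so all dependence on s sits in the
    monomial, whose exponent is t_i - 1 throughout group i.\<close>
  let ?E = "\<lambda>y. ?C * torus_monomial m r (\<lambda>i. t i - 1) y"
  assume part: "strict_mono_on {..<m} t \<and> d ` {..<k} = t ` {..<m} \<and>
        (\<forall>i<m. bij_betw (g i) {..<r i} {j. j < k \<and> d j = t i})"
  then have group: "(\<Prod>j<k. (of_nat q powr (- s j)) ^ (d j - 1)) =
      (\<Prod>i<m. \<Prod>l<r i. (of_nat q powr (- s (g i l))) ^ (t i - 1))" for s :: "nat \<Rightarrow> complex"
    by (intro prod_group_by_value) (auto intro: strict_mono_on_imp_inj_on)
  show "\<exists>E :: (nat \<Rightarrow> nat \<Rightarrow> complex) \<Rightarrow> complex.
           (\<forall>s :: nat \<Rightarrow> complex.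
              wd_epsilon K eps \<Phi> \<psi> n (sum_rep K (art K) k d s) (sum_nil k d) =
                E (\<lambda>i\<in>{..<m}. \<lambda>l\<in>{..<r i}. of_nat q powr (- s (g i l)))) \<and>
           (\<forall>y\<in>torus_product m r. \<forall>\<sigma>. (\<forall>i<m. \<sigma> i permutes {..<r i}) \<longrightarrow>
              E (\<lambda>i\<in>{..<m}. restrict (y i \<circ> \<sigma> i) {..<r i}) = E y) \<and>
           (\<exists>F. regular_on_quotient m r F \<and>
              (\<forall>y\<in>torus_product m r. E y = F (quotient_map_product m r y)))"
  proof (rule exI[of _ ?E], intro conjI allI impI ballI)
    fix s
    show "wd_epsilon K eps \<Phi> \<psi> n (sum_rep K (art K) k d s) (sum_nil k d) =
      ?E (\<lambda>i\<in>{..<m}. \<lambda>l\<in>{..<r i}. of_nat q powr (- s (g i l)))"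
      using eps[of s] group[of s] by (simp add: torus_monomial_def)
  next
    fix y \<sigma> assume "\<forall>i<m. \<sigma> i permutes {..<r i}"
    then have "torus_monomial m r (\<lambda>i. t i - 1) (\<lambda>i\<in>{..<m}. restrict (y i \<circ> \<sigma> i) {..<r i}) =
      torus_monomial m r (\<lambda>i. t i - 1) y"
      by (intro torus_monomial_permute[of m \<sigma>]) auto
    then show "?E (\<lambda>i\<in>{..<m}. restrict (y i \<circ> \<sigma> i) {..<r i}) = ?E y"
      by simp
  qed (rule scaled_torus_monomial_descends)
qed

end
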